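(* Let $K$ be a (not necessarily commutative) ring with unit, let $A$ be a $K$-algebra and let $B\subseteq A$ be a Boolean-Cartan restriction semigroup with respect to some given projections $P\subseteq B$. Then the map $a\mapsto\hat a$ is an isomorphism of $K$-algebras from $A$ onto $K\mathcal U(B)$, the algebra of compactly supported locally constant $K$-valued functions on the ultrafilter semicategory $\mathcal U(B)$ under convolution.
   Context: **$K$-algebras.** A $K$-algebra is a $K$-bimodule $A$ with a product $A\times A\to A$ that is distributive over addition and associative on $K\times A\times A$, $A\times K\times A$, $A\times A\times K$ and $A\times A\times A$. "Linear" means additive and compatible with left and right scalar multiplication. **Restriction semigroups.** Let $B$ be a semigroup with a distinguished commutative subsemigroup $P$ of idempotents ("projections"). Write $a\leq b$ iff $a=bp$ for some $p\in P$. The source projection of $a$, if it exists, is $\mathsf s(a)=\min\{p\in P: ap=a\}$. $B$ is a restriction semigroup (relative to $P$) if every element has a source projection (then $\leq$ is a partial order), $\mathsf s(ab)=\mathsf s(\mathsf s(a)b)$ for all $a,b\in B$, and $pb\leq b$ for all $p\in P$, $b\in B$. Write $a^{\geq}=\{c\in B: c\leq a\}$. **Boolean-Cartan.** Let $A$ be a $K$-algebra and $B\subseteq A$ a multiplicative subsemigroup whose elements commute with $K$ ($kb=bk$), which generates $A$ (equivalently, $A=\mathrm{span}(B)$), and which is a restriction semigroup with respect to a given $P\subseteq B$. $B$ is Boolean-Cartan if: (i) $kb\neq0$ whenever $k\in K\setminus\{0\}$, $b\in B\setminus\{0\}$; (ii) $p\leq q\in P$ implies $q-p\in P$; (iii)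 there is an operation $\wedge:A\times B\to A$, linear in the $A$ variable, such that $a\wedge b=\max(a^{\geq}\cap b^{\geq})$ (in $(B,\leq)$) for all $a,b\in B$. It then follows that $0\in P$ is the minimum of $B$. **Ultrafilter semicategory.** A filter in the poset $B$ is a non-empty up-set $F$ such that any $a,b\in F$ have a common lower bound in $F$; it is proper if $F\neq B$; an ultrafilter is a maximal proper filter. $\mathcal U(B)$ is the set of ultrafilters with the topology having basis $O_b=\{U\in\mathcal U(B): b\in U\}$, $b\in B$. The partial product is $V\cdot W=(VW)^{\leq}=\{c\in B:\exists v\in V,w\in W,\ vw\leq c\}$, defined precisely when $0\notin VW$. With this, $\mathcal U(B)$ is a Hausdorff ample semicategory, in particular the set $K\mathcal U(B)$ of functions $f:\mathcal U(B)\to K$ that are locally constant (continuous for the discrete topology on $K$) with support contained in a compact set is a $K$-algebra under pointwise addition and scalar multiplication and the convolution product $(fg)(U)=\sum_{V\cdot W=U}f(V)g(W)$ (finitely many non-zero terms). **The map.** For each ultrafilter $U\subseteq B$, the characteristic function of $U$ on $B$ (value $1$ on $U$, $0$ on $B\setminus U$) extends uniquely to a linear map $\chi_U:A\to K$. For $a\in A$ define $\hat a:\mathcal U(B)\to K$ by $\hat a(U)=\chi_U(a)$. *)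

theory Defs
  imports "HOL-Analysis.Analysis"
begin

text \<open>
  The coefficient ring has sort \<open>{ring, monoid_mult}\<close>, i.e. it is an arbitrary ring with unit,
  neither commutative nor necessarily nonzero (the class \<open>ring_1\<close> would force \<open>0 \<noteq> 1\<close>).
  The algebra has sort \<open>ring\<close>: an additive group with an associative distributive product and
  no unit.  The library's \<open>module\<close> requires commutative coefficients, hence the
  locale below.
\<close>

locale K_algebra =
  fixes lscale :: "'k::{ring,monoid_mult} \<Rightarrow> 'a::ring \<Rightarrow> 'a"
    and rscale :: "'a \<Rightarrow> 'k \<Rightarrow> 'a"
  assumes lscale_add_right: "lscale k (x + y) = lscale k x + lscale k y"
    and lscale_add_left: "lscale (k + l) x = lscale k x + lscale l x"
    and lscale_assoc: "lscale (k * l) x = lscale k (lscale l x)"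
    and lscale_one: "lscale 1 x = x"
    and rscale_add_left: "rscale (x + y) k = rscale x k + rscale y k"
    and rscale_add_right: "rscale x (k + l) = rscale x k + rscale x l"
    and rscale_assoc: "rscale x (k * l) = rscale (rscale x k) l"
    and rscale_one: "rscale x 1 = x"
    and lscale_rscale: "rscale (lscale k x) l = lscale k (rscale x l)"
    and lscale_mult: "lscale k x * y = lscale k (x * y)"
    and rscale_mult_lscale: "rscale x k * y = x * lscale k y"
    and mult_rscale: "x * rscale y k = rscale (x * y) k"

definition bimodule_linear ::
  "('k \<Rightarrow> 'a \<Rightarrow> 'a) \<Rightarrow> ('a \<Rightarrow> 'k \<Rightarrow> 'a) \<Rightarrow> ('k \<Rightarrow> 'b \<Rightarrow> 'b) \<Rightarrow> ('b \<Rightarrow> 'k \<Rightarrow> 'b) \<Rightarrow>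
   ('a::plus \<Rightarrow> 'b::plus) \<Rightarrow> bool" where
  "bimodule_linear ls rs ls' rs' f \<longleftrightarrow>
     (\<forall>x y. f (x + y) = f x + f y) \<and>
     (\<forall>k x. f (ls k x) = ls' k (f x)) \<and>
     (\<forall>x k. f (rs x k) = rs' (f x) k)"

inductive_set generated_subalgebra ::
  "('k \<Rightarrow> 'a::ring \<Rightarrow> 'a) \<Rightarrow> ('a \<Rightarrow> 'k \<Rightarrow> 'a) \<Rightarrow> 'a set \<Rightarrow> 'a set"
  for lscale rscale B where
  zero: "0 \<in> generated_subalgebra lscale rscale B"
| base: "b \<in> B \<Longrightarrow> b \<in> generated_subalgebra lscale rscale B"
| add: "x \<in> generated_subalgebra lscale rscale B \<Longrightarrow> y \<in> generated_subalgebra lscale rscale B \<Longrightarrow>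
    x + y \<in> generated_subalgebra lscale rscale B"
| lscale: "x \<in> generated_subalgebra lscale rscale B \<Longrightarrow>
    lscale k x \<in> generated_subalgebra lscale rscale B"
| rscale: "x \<in> generated_subalgebra lscale rscale B \<Longrightarrow>
    rscale x k \<in> generated_subalgebra lscale rscale B"
| mult: "x \<in> generated_subalgebra lscale rscale B \<Longrightarrow> y \<in> generated_subalgebra lscale rscale B \<Longrightarrow>
    x * y \<in> generated_subalgebra lscale rscale B"


text \<open>In \<open>below P a b\<close> the elements \<open>a\<close> and \<open>b\<close> are meant to range over \<open>B\<close> only.\<close>

definition below :: "'a::semigroup_mult set \<Rightarrow> 'a \<Rightarrow> 'a \<Rightarrow> bool" where
  "below P a b \<longleftrightarrow> (\<exists>p\<in>P. a = b * p)"

definition is_source :: "'a::semigroup_mult set \<Rightarrow> 'a \<Rightarrow> 'a \<Rightarrow> bool" where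
  "is_source P a p \<longleftrightarrow> p \<in> P \<and> a * p = a \<and> (\<forall>q\<in>P. a * q = a \<longrightarrow> below P p q)"

definition source :: "'a::semigroup_mult set \<Rightarrow> 'a \<Rightarrow> 'a" where
  "source P a = (THE p. is_source P a p)"

locale restriction_semigroup =
  fixes B P :: "'a::semigroup_mult set"
  assumes B_mult: "a \<in> B \<Longrightarrow> b \<in> B \<Longrightarrow> a * b \<in> B"
    and P_subset: "P \<subseteq> B"
    and P_mult: "p \<in> P \<Longrightarrow> q \<in> P \<Longrightarrow> p * q \<in> P"
    and P_commute: "p \<in> P \<Longrightarrow> q \<in> P \<Longrightarrow> p * q = q * p"
    and P_idem: "p \<in> P \<Longrightarrow> p * p = p"
    and source_exists: "a \<in> B \<Longrightarrow> \<exists>p. is_source P a p"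
    and source_mult: "a \<in> B \<Longrightarrow> b \<in> B \<Longrightarrow> source P (a * b) = source P (source P a * b)"
    and P_mult_below: "p \<in> P \<Longrightarrow> b \<in> B \<Longrightarrow> below P (p * b) b"

definition down :: "'a::semigroup_mult set \<Rightarrow> 'a set \<Rightarrow> 'a \<Rightarrow> 'a set" where
  "down B P a = {c \<in> B. below P c a}"

definition is_max :: "'a::semigroup_mult set \<Rightarrow> 'a set \<Rightarrow> 'a \<Rightarrow> bool" where
  "is_max P S m \<longleftrightarrow> m \<in> S \<and> (\<forall>c\<in>S. below P c m)"

locale boolean_cartan =
  K_algebra lscale rscale + restriction_semigroup B P
  for lscale :: "'k::{ring,monoid_mult} \<Rightarrow> 'a::ring \<Rightarrow> 'a"
    and rscale :: "'a \<Rightarrow> 'k \<Rightarrow> 'a"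
    and B P :: "'a set" +
  assumes B_central: "b \<in> B \<Longrightarrow> lscale k b = rscale b k"
    and B_generates: "generated_subalgebra lscale rscale B = UNIV"
    and torsion_free: "k \<noteq> 0 \<Longrightarrow> b \<in> B \<Longrightarrow> b \<noteq> 0 \<Longrightarrow> lscale k b \<noteq> 0"
    and P_diff: "p \<in> P \<Longrightarrow> q \<in> P \<Longrightarrow> below P p q \<Longrightarrow> q - p \<in> P"
    and linear_meet: "\<exists>meet :: 'a \<Rightarrow> 'a \<Rightarrow> 'a.
      (\<forall>b\<in>B. bimodule_linear lscale rscale lscale rscale (\<lambda>a. meet a b)) \<and>
      (\<forall>a\<in>B. \<forall>b\<in>B. is_max P (down B P a \<inter> down B P b) (meet a b))"


definition is_filter :: "'a::semigroup_mult set \<Rightarrow> 'a set \<Rightarrow> 'a set \<Rightarrow> bool" where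
  "is_filter B P F \<longleftrightarrow>
     F \<subseteq> B \<and> F \<noteq> {} \<and>
     (\<forall>a\<in>F. \<forall>b\<in>B. below P a b \<longrightarrow> b \<in> F) \<and>
     (\<forall>a\<in>F. \<forall>b\<in>F. \<exists>c\<in>F. below P c a \<and> below P c b)"

definition ultrafilters :: "'a::semigroup_mult set \<Rightarrow> 'a set \<Rightarrow> 'a set set" where
  "ultrafilters B P =
     {U. is_filter B P U \<and> U \<noteq> B \<and>
         (\<forall>F. is_filter B P F \<longrightarrow> F \<noteq> B \<longrightarrow> U \<subseteq> F \<longrightarrow> F = U)}"

definition ultrafilter_topology :: "'a::semigroup_mult set \<Rightarrow> 'a set \<Rightarrow> 'a set topology" where
  "ultrafilter_topology B P =
     topology_generated_by ((\<lambda>b. {U \<in> ultrafilters B P. b \<in> U}) ` B)"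

definition uf_composable :: "'a::ring set \<Rightarrow> 'a set \<Rightarrow> bool" where
  "uf_composable V W \<longleftrightarrow> (\<forall>v\<in>V. \<forall>w\<in>W. v * w \<noteq> 0)"

definition uf_prod :: "'a::ring set \<Rightarrow> 'a set \<Rightarrow> 'a set \<Rightarrow> 'a set \<Rightarrow> 'a set" where
  "uf_prod B P V W = {c \<in> B. \<exists>v\<in>V. \<exists>w\<in>W. below P (v * w) c}"


text \<open>
  A function on the set of ultrafilters is represented by its unique extensional representative,
  with value \<open>undefined\<close> at sets that are not ultrafilters.
\<close>

definition KU :: "'a::ring set \<Rightarrow> 'a set \<Rightarrow> ('a set \<Rightarrow> 'k::{ring,monoid_mult}) set" where
  "KU B P =
     {f \<in> extensional (ultrafilters B P).
        continuous_map (ultrafilter_topology B P) (discrete_topology UNIV) f \<and>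
        (\<exists>C. compactin (ultrafilter_topology B P) C \<and>
             {U \<in> ultrafilters B P. f U \<noteq> 0} \<subseteq> C)}"

definition KU_add ::
  "'a::ring set \<Rightarrow> 'a set \<Rightarrow> ('a set \<Rightarrow> 'k::{ring,monoid_mult}) \<Rightarrow> ('a set \<Rightarrow> 'k) \<Rightarrow> ('a set \<Rightarrow> 'k)" where
  "KU_add B P f g = (\<lambda>U\<in>ultrafilters B P. f U + g U)"

definition KU_lscale ::
  "'a::ring set \<Rightarrow> 'a set \<Rightarrow> 'k::{ring,monoid_mult} \<Rightarrow> ('a set \<Rightarrow> 'k) \<Rightarrow> ('a set \<Rightarrow> 'k)" where
  "KU_lscale B P k f = (\<lambda>U\<in>ultrafilters B P. k * f U)"

definition KU_rscale ::
  "'a::ring set \<Rightarrow> 'a set \<Rightarrow> ('a set \<Rightarrow> 'k::{ring,monoid_mult}) \<Rightarrow> 'k \<Rightarrow> ('a set \<Rightarrow> 'k)" where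
  "KU_rscale B P f k = (\<lambda>U\<in>ultrafilters B P. f U * k)"

text \<open>The index set of the non-zero terms of the convolution sum at \<open>U\<close>.\<close>

definition conv_support ::
  "'a::ring set \<Rightarrow> 'a set \<Rightarrow> ('a set \<Rightarrow> 'k::{ring,monoid_mult}) \<Rightarrow> ('a set \<Rightarrow> 'k) \<Rightarrow> 'a set \<Rightarrow>
   ('a set \<times> 'a set) set" where
  "conv_support B P f g U =
     {(V, W). V \<in> ultrafilters B P \<and> W \<in> ultrafilters B P \<and>
        uf_composable V W \<and> uf_prod B P V W = U \<and> f V * g W \<noteq> 0}"

definition KU_conv ::
  "'a::ring set \<Rightarrow> 'a set \<Rightarrow> ('a set \<Rightarrow> 'k::{ring,monoid_mult}) \<Rightarrow> ('a set \<Rightarrow> 'k) \<Rightarrow> ('a set \<Rightarrow> 'k)" where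
  "KU_conv B P f g =
     (\<lambda>U\<in>ultrafilters B P. \<Sum>(V, W)\<in>conv_support B P f g U. f V * g W)"


definition is_char_ext ::
  "('k::{ring,monoid_mult} \<Rightarrow> 'a::ring \<Rightarrow> 'a) \<Rightarrow> ('a \<Rightarrow> 'k \<Rightarrow> 'a) \<Rightarrow> 'a set \<Rightarrow> 'a set \<Rightarrow>
   ('a \<Rightarrow> 'k) \<Rightarrow> bool" where
  "is_char_ext lscale rscale B U \<phi> \<longleftrightarrow>
     bimodule_linear lscale rscale (*) (*) \<phi> \<and> (\<forall>b\<in>B. \<phi> b = (if b \<in> U then 1 else 0))"

definition char_ext ::
  "('k::{ring,monoid_mult} \<Rightarrow> 'a::ring \<Rightarrow> 'a) \<Rightarrow> ('a \<Rightarrow> 'k \<Rightarrow> 'a) \<Rightarrow> 'a set \<Rightarrow> 'a set \<Rightarrow> 'a \<Rightarrow> 'k" where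
  "char_ext lscale rscale B U = (THE \<phi>. is_char_ext lscale rscale B U \<phi>)"

definition hat ::
  "('k::{ring,monoid_mult} \<Rightarrow> 'a::ring \<Rightarrow> 'a) \<Rightarrow> ('a \<Rightarrow> 'k \<Rightarrow> 'a) \<Rightarrow> 'a set \<Rightarrow> 'a set \<Rightarrow>
   'a \<Rightarrow> 'a set \<Rightarrow> 'k" where
  "hat lscale rscale B P a = (\<lambda>U\<in>ultrafilters B P. char_ext lscale rscale B U a)"

end

theory Submission
  imports Defs
begin

text \<open>
  Every \<open>a\<close> in \<open>A\<close> acts near an ultrafilter \<open>U\<close> as a scalar: there are \<open>u\<close> in \<open>U\<close> and \<open>k\<close> with
  \<open>a \<and> v = k v\<close> for all \<open>v \<le> u\<close>.  This is clear for elements of \<open>B\<close>, since an element of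
  \<open>B\<close> outside \<open>U\<close> is disjoint from some member of \<open>U\<close>, and it is preserved by linear
  combinations.  By torsion-freeness \<open>k\<close> is unique, so it is a well-defined linear function of \<open>a\<close>
  extending the characteristic function of \<open>U\<close>, and it is locally constant in \<open>U\<close>.  Relative
  complements make the basic open sets compact.  Compactness yields injectivity, because \<open>a \<and> b\<close>
  vanishes for all \<open>b\<close> if \<open>a\<close> vanishes near every ultrafilter, and surjectivity, because the range is
  closed under multiplication by the indicators of basic open sets.

  For multiplicativity, \<open>U\<close> is determined by any of its members together with the
  prime filter \<open>src U\<close> of projections fixing some member from the right, and \<open>tgt U\<close> denotes the
  analogous filter on the left.  If \<open>U = V \<cdot> W\<close> then \<open>src U = src W\<close> and \<open>tgt W = src V\<close>.  Hence
  for \<open>b\<close>, \<open>c\<close> in \<open>B\<close> there is at most one factorization of \<open>U\<close> with \<open>b\<close> in \<open>V\<close> and \<open>c\<close>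
  in \<open>W\<close>, and there is one exactly if \<open>b c\<close> lies in \<open>U\<close>.
\<close>

section \<open>Order and filters in restriction semigroups\<close>

context restriction_semigroup
begin

abbreviation leq (infix "\<preceq>" 50) where "x \<preceq> y \<equiv> below P x y"

lemma P_in_B: "p \<in> P \<Longrightarrow> p \<in> B"
  using P_subset by auto

lemma right_unit_exists:
  assumes "a \<in> B"
  obtains s where "s \<in> P" "a * s = a"
  using source_exists[OF assms] by (auto simp: is_source_def)

lemma below_refl: "a \<in> B \<Longrightarrow> a \<preceq> a"
  by (metis below_def right_unit_exists)

lemma below_trans: "a \<preceq> b \<Longrightarrow> b \<preceq> c \<Longrightarrow> a \<preceq> c"
  unfolding below_def by (metis P_mult mult.assoc)

lemma below_antisym:
  assumes "a \<preceq> b" "b \<preceq> a"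
  shows "a = b"
proof -
  obtain p q where p: "p \<in> P" "a = b * p" and q: "q \<in> P" "b = a * q"
    using assms by (auto simp: below_def)
  have "b * p = a * (q * p)"
    using q by (metis mult.assoc)
  also have "\<dots> = a * p * q"
    using p q P_commute by (metis mult.assoc)
  also have "\<dots> = b"
    using p q P_idem by (metis mult.assoc)
  finally show ?thesis using p by simp
qed

lemma below_in_B: "a \<preceq> b \<Longrightarrow> b \<in> B \<Longrightarrow> a \<in> B"
  using B_mult P_in_B by (auto simp: below_def)

lemma mult_P_below: "p \<in> P \<Longrightarrow> b * p \<preceq> b"
  by (auto simp: below_def)

lemma below_mult_P_right: "a \<preceq> b \<Longrightarrow> b * p = b \<Longrightarrow> p \<in> P \<Longrightarrow> a * p = a"
  unfolding below_def by (metis P_commute mult.assoc)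

lemma below_mult_P_left: "a \<preceq> b \<Longrightarrow> p * b = b \<Longrightarrow> p * a = a"
  unfolding below_def by (metis mult.assoc)

lemma mult_P_mono: "a \<preceq> b \<Longrightarrow> p \<in> P \<Longrightarrow> a * p \<preceq> b * p"
  unfolding below_def by (metis P_commute mult.assoc)

lemma mult_left_mono_below: "a \<preceq> b \<Longrightarrow> c * a \<preceq> c * b"
  unfolding below_def by (metis mult.assoc)

text \<open>The axiom \<open>P_mult_below\<close> moves a projection from the left of
  \<open>c\<close> to its right, in exchange for another projection \<open>q\<close>.\<close>

lemma mult_right_mono_below:
  assumes "a \<preceq> b" "c \<in> B"
  shows "a * c \<preceq> b * c"
proof -
  obtain p where p: "p \<in> P" "a = b * p" using assms by (auto simp: below_def)
  obtain q where "q \<in> P" "p * c = c * q"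
    using P_mult_below[OF p(1) assms(2)] by (auto simp: below_def)
  then show ?thesis using p by (auto simp: below_def mult.assoc)
qed

section \<open>Filters and filter bases\<close>

lemma filter_subset: "is_filter B P F \<Longrightarrow> a \<in> F \<Longrightarrow> a \<in> B"
  by (auto simp: is_filter_def)

lemma filter_up: "is_filter B P F \<Longrightarrow> a \<in> F \<Longrightarrow> a \<preceq> b \<Longrightarrow> b \<in> B \<Longrightarrow> b \<in> F"
  by (auto simp: is_filter_def)

lemma filter_directed:
  assumes "is_filter B P F" "a \<in> F" "b \<in> F"
  obtains c where "c \<in> F" "c \<preceq> a" "c \<preceq> b"
  using assms unfolding is_filter_def by blast

definition up_closure :: "'a set \<Rightarrow> 'a set" where
  "up_closure S = {c \<in> B. \<exists>s\<in>S. s \<preceq> c}"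

text \<open>Filters are constructed below as up-closures of down-directed sets, so that only
  directedness of a base has to be checked.\<close>

lemma is_filter_up_closure:
  assumes "S \<subseteq> B" "S \<noteq> {}"
    and "\<And>a b. a \<in> S \<Longrightarrow> b \<in> S \<Longrightarrow> \<exists>c\<in>S. c \<preceq> a \<and> c \<preceq> b"
  shows "is_filter B P (up_closure S)"
  unfolding is_filter_def
proof (intro conjI ballI impI)
  show "up_closure S \<subseteq> B" by (auto simp: up_closure_def)
  show "up_closure S \<noteq> {}"
    using assms(1,2) below_refl by (fastforce simp: up_closure_def)
  fix a b assume "a \<in> up_closure S" "b \<in> B" "a \<preceq> b"
  then show "b \<in> up_closure S" using below_trans by (auto simp: up_closure_def)
next
  fix a b assume "a \<in> up_closure S" "b \<in> up_closure S"
  then obtain s t where st: "s \<in> S" "s \<preceq> a" "t \<in> S" "t \<preceq> b"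
    by (auto simp: up_closure_def)
  then obtain c where c: "c \<in> S" "c \<preceq> s" "c \<preceq> t" using assms(3) by blast
  then have "c \<in> up_closure S" using assms(1) below_refl by (auto simp: up_closure_def)
  then show "\<exists>c\<in>up_closure S. c \<preceq> a \<and> c \<preceq> b"
    using c st below_trans by blast
qed

lemma subset_up_closure: "S \<subseteq> B \<Longrightarrow> S \<subseteq> up_closure S"
  using below_refl by (auto simp: up_closure_def)

end

section \<open>Linear spans and meets\<close>

context K_algebra
begin

lemma lscale_zero_left [simp]: "lscale 0 x = 0"
  using lscale_add_left[of 0 0 x] by simp

lemma lscale_zero_right [simp]: "lscale k 0 = 0"
  using lscale_add_right[of k 0 0] by simp

lemma rscale_zero_left [simp]: "rscale 0 k = 0"
  using rscale_add_left[of 0 0 k] by simp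

lemma lscale_diff_left: "lscale (k - l) x = lscale k x - lscale l x"
  using lscale_add_left[of "k - l" l x] by simp

lemma lscale_diff_right: "lscale k (x - y) = lscale k x - lscale k y"
  using lscale_add_right[of k "x - y" y] by simp

end

section \<open>The algebra as the left linear span of \<open>B\<close>\<close>

context boolean_cartan
begin

text \<open>Centrality turns \<open>k b\<close> into \<open>b k\<close>, after which
  \<open>k\<close> can be passed on to \<open>c\<close>; the scalars keep their order, as the ring
  need not be commutative.\<close>

lemma lscale_mult_lscale:
  assumes "b \<in> B" "c \<in> B"
  shows "lscale k b * lscale l c = lscale (k * l) (b * c)"
proof -
  have "lscale k b * lscale l c = b * lscale k (lscale l c)"
    using assms B_central rscale_mult_lscale by metis
  also have "\<dots> = rscale (b * c) (k * l)"
    using assms B_central by (metis lscale_assoc mult_rscale)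
  finally show ?thesis using assms B_mult B_central by metis
qed

lemma rscale_lscale: "b \<in> B \<Longrightarrow> rscale (lscale k b) l = lscale (k * l) b"
  by (metis B_central lscale_assoc lscale_rscale)

text \<open>Left multiples suffice because \<open>B\<close> is closed under products and commutes
  with scalars. Adding one multiple at a time gives an induction with a single step, on which all
  extensions from \<open>B\<close> to the whole algebra rest.\<close>

inductive_set lspan :: "'a set" where
  zero: "0 \<in> lspan"
| add: "x \<in> lspan \<Longrightarrow> b \<in> B \<Longrightarrow> x + lscale k b \<in> lspan"

lemma lspan_add: "y \<in> lspan \<Longrightarrow> x \<in> lspan \<Longrightarrow> x + y \<in> lspan"
  by (induction rule: lspan.induct) (auto simp: add.assoc[symmetric] intro: lspan.intros)

lemma lspan_base: "b \<in> B \<Longrightarrow> lscale k b \<in> lspan"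
  using lspan.add[OF lspan.zero] by simp

lemma lspan_mult_right: "y \<in> lspan \<Longrightarrow> b \<in> B \<Longrightarrow> lscale k b * y \<in> lspan"
  by (induction rule: lspan.induct)
    (auto simp: distrib_left lscale_mult_lscale intro!: lspan.intros B_mult)

lemma lspan_mult: "x \<in> lspan \<Longrightarrow> y \<in> lspan \<Longrightarrow> x * y \<in> lspan"
  by (induction rule: lspan.induct)
    (auto simp: distrib_right intro: lspan.intros lspan_add lspan_mult_right)

lemma lspan_UNIV: "x \<in> lspan"
proof -
  have "x \<in> generated_subalgebra lscale rscale B" using B_generates by simp
  then show ?thesis
  proof (induction rule: generated_subalgebra.induct)
    case (base b)
    then show ?case using lspan_base[of b 1] by (simp add: lscale_one)
  next
    case (lscale x k)
    show ?case using lscale.IH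
      by (induction rule: lspan.induct)
        (auto simp: lscale_add_right lscale_assoc[symmetric] intro: lspan.intros)
  next
    case (rscale x k)
    show ?case using rscale.IH
      by (induction rule: lspan.induct)
        (auto simp: rscale_add_left rscale_lscale intro: lspan.intros)
  qed (auto intro: lspan.intros lspan_add lspan_mult)
qed

lemma span_induct [case_names zero add]:
  assumes "Q 0" "\<And>x b k. Q x \<Longrightarrow> b \<in> B \<Longrightarrow> Q (x + lscale k b)"
  shows "Q x"
  using lspan_UNIV[of x] by (induction rule: lspan.induct) (auto intro: assms)

section \<open>Meets, linear in the first argument\<close>

definition meet :: "'a \<Rightarrow> 'a \<Rightarrow> 'a" where
  "meet = (SOME meet.
      (\<forall>b\<in>B. bimodule_linear lscale rscale lscale rscale (\<lambda>a. meet a b)) \<and>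
      (\<forall>a\<in>B. \<forall>b\<in>B. is_max P (down B P a \<inter> down B P b) (meet a b)))"

lemma meet_linear: "b \<in> B \<Longrightarrow> bimodule_linear lscale rscale lscale rscale (\<lambda>a. meet a b)"
  and meet_is_max: "a \<in> B \<Longrightarrow> b \<in> B \<Longrightarrow> is_max P (down B P a \<inter> down B P b) (meet a b)"
  using someI_ex[OF linear_meet] unfolding meet_def[symmetric] by auto

lemma meet_add: "b \<in> B \<Longrightarrow> meet (x + y) b = meet x b + meet y b"
  and meet_lscale: "b \<in> B \<Longrightarrow> meet (lscale k x) b = lscale k (meet x b)"
  and meet_rscale: "b \<in> B \<Longrightarrow> meet (rscale x k) b = rscale (meet x b) k"
  using meet_linear by (auto simp: bimodule_linear_def)

lemma meet_zero_left [simp]: "b \<in> B \<Longrightarrow> meet 0 b = 0"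
  using meet_add[of b 0 0] by simp

lemma meet_diff: "b \<in> B \<Longrightarrow> meet (x - y) b = meet x b - meet y b"
  using meet_add[of b "x - y" y] by simp

lemma meet_in_B [simp]: "a \<in> B \<Longrightarrow> b \<in> B \<Longrightarrow> meet a b \<in> B"
  and meet_below1: "a \<in> B \<Longrightarrow> b \<in> B \<Longrightarrow> meet a b \<preceq> a"
  and meet_below2: "a \<in> B \<Longrightarrow> b \<in> B \<Longrightarrow> meet a b \<preceq> b"
  and meet_greatest: "a \<in> B \<Longrightarrow> b \<in> B \<Longrightarrow> c \<preceq> a \<Longrightarrow> c \<preceq> b \<Longrightarrow> c \<preceq> meet a b"
  using meet_is_max[of a b] below_in_B by (auto simp: is_max_def down_def)

lemma meet_commute: "a \<in> B \<Longrightarrow> b \<in> B \<Longrightarrow> meet a b = meet b a"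
  by (simp add: below_antisym meet_below1 meet_below2 meet_greatest)

lemma meet_absorb: "a \<in> B \<Longrightarrow> b \<in> B \<Longrightarrow> a \<preceq> b \<Longrightarrow> meet b a = a"
  by (simp add: below_antisym meet_below2 meet_greatest below_refl)

lemma meet_mono: "a \<preceq> a' \<Longrightarrow> b \<preceq> b' \<Longrightarrow> a' \<in> B \<Longrightarrow> b' \<in> B \<Longrightarrow> meet a b \<preceq> meet a' b'"
  by (meson below_in_B below_trans meet_below1 meet_below2 meet_greatest)

lemma meet_assoc_B:
  "a \<in> B \<Longrightarrow> b \<in> B \<Longrightarrow> c \<in> B \<Longrightarrow> meet (meet a b) c = meet a (meet b c)"
  by (rule below_antisym)
    (meson below_trans meet_below1 meet_below2 meet_greatest meet_in_B)+

lemma meet_assoc: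
  assumes "b \<in> B" "c \<in> B"
  shows "meet (meet x b) c = meet x (meet b c)"
  by (induction x rule: span_induct)
    (simp_all add: assms meet_add meet_lscale meet_assoc_B)

lemma meet_right_commute: "b \<in> B \<Longrightarrow> c \<in> B \<Longrightarrow> meet (meet x b) c = meet (meet x c) b"
  by (simp add: meet_assoc meet_commute)

text \<open>\<open>0\<close> is \<open>p - p\<close> for a right unit \<open>p\<close> of
  \<open>b\<close>. The hypothesis excludes an empty \<open>B\<close>, which the assumptions allow
  when the algebra is zero.\<close>

lemma zero_in_P: "b \<in> B \<Longrightarrow> 0 \<in> P"
  by (metis P_diff P_in_B below_refl cancel_comm_monoid_add_class.diff_cancel right_unit_exists)

lemma zero_below: "b \<in> B \<Longrightarrow> 0 \<preceq> b"
  unfolding below_def by (metis zero_in_P mult_zero_right)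

lemma below_zero: "a \<preceq> 0 \<Longrightarrow> a = 0"
  by (auto simp: below_def)

section \<open>Relative complements\<close>

lemma diff_in_P: "p \<in> P \<Longrightarrow> q \<in> P \<Longrightarrow> q - q * p \<in> P"
  by (simp add: P_diff P_mult mult_P_below)

text \<open>A right unit \<open>s\<close> of \<open>x\<close> rewrites the difference as
  \<open>x\<close> times a projection, which keeps it in \<open>B\<close> and below
  \<open>x\<close>.\<close>

lemma diff_factor:
  assumes "y \<preceq> x" "x \<in> B"
  obtains s p where "s \<in> P" "p \<in> P" "x * s = x" "y = x * p" "x - y = x * (s - s * p)"
proof -
  obtain s where s: "s \<in> P" "x * s = x" using assms right_unit_exists by blast
  obtain p where p: "p \<in> P" "y = x * p" using assms by (auto simp: below_def)
  have "x - y = x * (s - s * p)"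
    using s p by (simp add: right_diff_distrib mult.assoc[symmetric])
  with s p that show ?thesis by blast
qed

lemma diff_below: "y \<preceq> x \<Longrightarrow> x \<in> B \<Longrightarrow> x - y \<preceq> x"
  by (metis diff_factor diff_in_P mult_P_below)

lemma diff_in_B: "y \<preceq> x \<Longrightarrow> x \<in> B \<Longrightarrow> x - y \<in> B"
  using below_in_B diff_below by blast

text \<open>On \<open>B\<close> the meet is symmetric, so linearity on the left carries over to the
  right; linearity in \<open>a\<close> then extends the identity from \<open>B\<close> to its
  span.\<close>

lemma meet_diff_right:
  assumes "y \<preceq> x" "x \<in> B"
  shows "meet a (x - y) = meet a x - meet a y"
proof -
  have B: "y \<in> B" "x - y \<in> B" using assms below_in_B diff_in_B by auto
  have *: "meet b (x - y) = meet b x - meet b y" if "b \<in> B" for b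
    using that B assms meet_commute meet_diff by metis
  show ?thesis
    by (induction a rule: span_induct)
      (simp_all add: assms B meet_add meet_lscale * lscale_diff_right)
qed

lemma meet_zero_right [simp]: "b \<in> B \<Longrightarrow> meet a 0 = 0"
  using meet_diff_right[of b b a] below_refl by simp

text \<open>A product of the commuting operators \<open>x \<mapsto> x - meet x d\<close> fixes every \<open>a\<close> all of whose meets
  vanish, and kills \<open>a\<close> if \<open>d\<close> runs through the terms of \<open>a\<close>; this replaces the decomposition of
  \<open>a\<close> into orthogonal elements of \<open>B\<close>.\<close>

definition strip :: "'a list \<Rightarrow> 'a \<Rightarrow> 'a" where
  "strip ds x = fold (\<lambda>d x. x - meet x d) ds x"

lemma strip_Nil [simp]: "strip [] x = x"
  and strip_Cons: "strip (d # ds) x = strip ds (x - meet x d)"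
  and strip_append: "strip (ds @ es) x = strip es (strip ds x)"
  by (auto simp: strip_def)

lemma strip_zero [simp]: "set ds \<subseteq> B \<Longrightarrow> strip ds 0 = 0"
  by (induction ds) (auto simp: strip_Cons)

lemma strip_add: "set ds \<subseteq> B \<Longrightarrow> strip ds (x + y) = strip ds x + strip ds y"
  by (induction ds arbitrary: x y) (auto simp: strip_Cons meet_add add_diff_add)

lemma strip_commute1:
  assumes "d \<in> B"
  shows "set es \<subseteq> B \<Longrightarrow> strip es (x - meet x d) = strip es x - meet (strip es x) d"
proof (induction es arbitrary: x)
  case (Cons e es)
  have "x - meet x d - meet (x - meet x d) e = (x - meet x e) - meet (x - meet x e) d"
    using Cons.prems assms by (simp add: meet_diff meet_right_commute[of d e] algebra_simps)
  then have "strip (e # es) (x - meet x d) = strip es ((x - meet x e) - meet (x - meet x e) d)"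
    by (simp only: strip_Cons)
  also have "\<dots> = strip (e # es) x - meet (strip (e # es) x) d"
    using Cons by (simp add: strip_Cons)
  finally show ?case .
qed simp

lemma strip_commute:
  "set ds \<subseteq> B \<Longrightarrow> set es \<subseteq> B \<Longrightarrow> strip ds (strip es x) = strip es (strip ds x)"
  by (induction ds arbitrary: x) (simp_all add: strip_Cons strip_commute1)

lemma strip_below: "set ds \<subseteq> B \<Longrightarrow> x \<in> B \<Longrightarrow> strip ds x \<in> B \<and> strip ds x \<preceq> x"
proof (induction ds arbitrary: x)
  case (Cons d ds)
  have "x - meet x d \<in> B" "x - meet x d \<preceq> x"
    using Cons.prems by (simp_all add: diff_in_B diff_below meet_below1)
  then show ?case using Cons below_trans by (simp add: strip_Cons) blast
qed (simp add: below_refl)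

text \<open>The operator for \<open>b\<close> kills \<open>k b\<close>. Since the operators commute,
  appending it to a list that kills \<open>x\<close> gives a list that kills
  \<open>x + k b\<close>.\<close>

lemma ex_strip_eq_zero: "\<exists>ds. set ds \<subseteq> B \<and> strip ds a = 0"
proof (induction a rule: span_induct)
  case zero
  show ?case by (rule exI[of _ "[]"]) simp
next
  case (add x b k)
  then obtain ds where ds: "set ds \<subseteq> B" "strip ds x = 0" by blast
  have "lscale k b - meet (lscale k b) b = 0"
    using add by (simp add: meet_lscale meet_absorb below_refl)
  then have "strip [b] (lscale k b) = 0" by (simp add: strip_Cons)
  then have "strip (ds @ [b]) (x + lscale k b) = 0"
    using ds add strip_commute[of ds "[b]" "lscale k b"]
    by (simp add: strip_append strip_add)
  then show ?case using ds add by (intro exI[of _ "ds @ [b]"]) auto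
qed

lemma eq_zero_if_meets_zero:
  assumes "\<And>b. b \<in> B \<Longrightarrow> meet a b = 0"
  shows "a = 0"
proof -
  have "strip ds a = a" if "set ds \<subseteq> B" for ds
    using that by (induction ds) (auto simp: strip_Cons assms)
  then show ?thesis using ex_strip_eq_zero[of a] by metis
qed

section \<open>Ultrafilters\<close>

abbreviation "UF \<equiv> ultrafilters B P"

text \<open>An up-set containing the minimum \<open>0\<close> is all of \<open>B\<close>.\<close>

lemma filter_proper_iff: "is_filter B P F \<Longrightarrow> F \<noteq> B \<longleftrightarrow> 0 \<notin> F"
  by (metis P_in_B filter_up is_filter_def subsetI subset_antisym zero_below zero_in_P
      ex_in_conv)

lemma uf_filter: "U \<in> UF \<Longrightarrow> is_filter B P U"
  by (simp add: ultrafilters_def)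

lemma uf_zero: "U \<in> UF \<Longrightarrow> 0 \<notin> U"
  using filter_proper_iff by (auto simp: ultrafilters_def)

lemma uf_maximal: "U \<in> UF \<Longrightarrow> is_filter B P F \<Longrightarrow> 0 \<notin> F \<Longrightarrow> U \<subseteq> F \<Longrightarrow> F = U"
  using filter_proper_iff by (auto simp: ultrafilters_def)

lemma ufI:
  assumes "is_filter B P U" "0 \<notin> U"
    "\<And>F. is_filter B P F \<Longrightarrow> 0 \<notin> F \<Longrightarrow> U \<subseteq> F \<Longrightarrow> F \<subseteq> U"
  shows "U \<in> UF"
  using assms filter_proper_iff unfolding ultrafilters_def by blast

lemmas uf_in_B = filter_subset[OF uf_filter]
lemmas uf_up = filter_up[OF uf_filter]
lemmas uf_directed = filter_directed[OF uf_filter]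

lemma uf_nonempty: "U \<in> UF \<Longrightarrow> \<exists>u. u \<in> U"
  using uf_filter[of U] unfolding is_filter_def by blast

lemma uf_meet_iff: "U \<in> UF \<Longrightarrow> a \<in> B \<Longrightarrow> b \<in> B \<Longrightarrow> meet a b \<in> U \<longleftrightarrow> a \<in> U \<and> b \<in> U"
  by (meson meet_below1 meet_below2 meet_greatest meet_in_B uf_directed uf_up)

text \<open>If no meet \<open>u \<and> b\<close> with \<open>u\<close> in \<open>U\<close> were
  zero, these meets would generate a proper filter containing \<open>U\<close> and \<open>b\<close>,
  against maximality of \<open>U\<close>.\<close>

lemma uf_separate:
  assumes U: "U \<in> UF" and b: "b \<in> B" "b \<notin> U"
  obtains u where "u \<in> U" "meet u b = 0"
proof (rule ccontr)
  assume neg: "\<not> thesis"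
  define S where "S = (\<lambda>u. meet u b) ` U"
  have S: "S \<subseteq> B" using b uf_in_B[OF U] by (auto simp: S_def)
  have filt: "is_filter B P (up_closure S)"
  proof (rule is_filter_up_closure[OF S])
    show "S \<noteq> {}" using uf_nonempty[OF U] by (auto simp: S_def)
    fix x y assume "x \<in> S" "y \<in> S"
    then obtain u v where uv: "u \<in> U" "v \<in> U" "x = meet u b" "y = meet v b"
      by (auto simp: S_def)
    obtain w where "w \<in> U" "w \<preceq> u" "w \<preceq> v" using uf_directed[OF U uv(1,2)] .
    then show "\<exists>c\<in>S. c \<preceq> x \<and> c \<preceq> y"
      using uv b uf_in_B[OF U] by (auto simp: S_def intro!: meet_mono below_refl)
  qed
  have "0 \<notin> up_closure S"
    using neg that below_zero by (fastforce simp: up_closure_def S_def)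
  moreover have "U \<subseteq> up_closure S" 
    using b uf_in_B[OF U] meet_below1 by (fastforce simp: up_closure_def S_def)
  ultimately have "up_closure S = U" using uf_maximal[OF U filt] by blast
  moreover have "b \<in> up_closure S"
    using b uf_in_B[OF U] meet_below2 uf_nonempty[OF U] by (fastforce simp: up_closure_def S_def)
  ultimately show False using b by simp
qed

lemma uf_separate_below:
  assumes U: "U \<in> UF" and b: "b \<in> B" "b \<notin> U" and c: "c \<in> U"
  obtains u where "u \<in> U" "u \<preceq> c" "meet u b = 0"
proof -
  obtain v where v: "v \<in> U" "meet v b = 0" using uf_separate[OF U b] .
  obtain u where u: "u \<in> U" "u \<preceq> v" "u \<preceq> c" using uf_directed[OF U v(1) c] .
  have "meet u b \<preceq> meet v b"
    using u v b uf_in_B[OF U] by (intro meet_mono) (auto intro: below_refl)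
  then show ?thesis using that u v below_zero by metis
qed

lemma ex_ultrafilter:
  assumes F: "is_filter B P F" "0 \<notin> F"
  obtains U where "U \<in> UF" "F \<subseteq> U"
proof -
  define A where "A = {G. is_filter B P G \<and> 0 \<notin> G \<and> F \<subseteq> G}"
  have "\<exists>M\<in>A. \<forall>X\<in>A. M \<subseteq> X \<longrightarrow> X = M"
  proof (rule subset_Zorn_nonempty)
    show "A \<noteq> {}" using F by (auto simp: A_def)
    fix C assume C: "C \<noteq> {}" "subset.chain A C"
    then have CA: "\<And>G. G \<in> C \<Longrightarrow> is_filter B P G \<and> 0 \<notin> G \<and> F \<subseteq> G"
      by (auto simp: subset_chain_def A_def)
    have tot: "\<And>G H. G \<in> C \<Longrightarrow> H \<in> C \<Longrightarrow> G \<subseteq> H \<or> H \<subseteq> G"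
      using C by (auto simp: subset_chain_def)
    have "is_filter B P (\<Union>C)"
      unfolding is_filter_def
    proof (intro conjI ballI impI)
      show "\<Union>C \<subseteq> B" using CA filter_subset by blast
      show "\<Union>C \<noteq> {}" using C CA by (fastforce simp: is_filter_def)
      show "b \<in> \<Union>C" if "a \<in> \<Union>C" "b \<in> B" "a \<preceq> b" for a b
        using that CA filter_up by blast
      fix a b assume "a \<in> \<Union>C" "b \<in> \<Union>C"
      then obtain G where "G \<in> C" "a \<in> G" "b \<in> G" using tot by blast
      then show "\<exists>c\<in>\<Union>C. c \<preceq> a \<and> c \<preceq> b" using CA filter_directed by (metis UnionI)
    qed
    then show "\<Union>C \<in> A" using C CA by (auto simp: A_def)
  qed
  then obtain M where M: "M \<in> A" "\<forall>X\<in>A. M \<subseteq> X \<longrightarrow> X = M" by blast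
  then have "M \<in> UF" by (intro ufI) (auto simp: A_def)
  then show ?thesis using that M by (auto simp: A_def)
qed

text \<open>Algebraic form of compactness, with \<open>strip cs b\<close> as the part of
  \<open>b\<close> outside all members of \<open>cs\<close>. If these remainders were never zero,
  some ultrafilter would contain them all; it contains \<open>b\<close>, hence some \<open>c\<close>
  in \<open>C\<close>, but also \<open>b - meet b c\<close>, which is disjoint from
  \<open>c\<close>.\<close>

lemma finite_cover_strip:
  assumes b: "b \<in> B" and C: "C \<subseteq> B"
    and cover: "\<And>U. U \<in> UF \<Longrightarrow> b \<in> U \<Longrightarrow> U \<inter> C \<noteq> {}"
  obtains cs where "set cs \<subseteq> C" "strip cs b = 0"
proof (rule ccontr)
  assume neg: "\<not> thesis"
  define S where "S = {strip cs b | cs. set cs \<subseteq> C}"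
  have S: "S \<subseteq> B" using b C strip_below by (auto simp: S_def)
  have filt: "is_filter B P (up_closure S)"
  proof (rule is_filter_up_closure[OF S])
    have "strip [] b \<in> S" unfolding S_def by (auto simp del: strip_Nil intro!: exI[of _ "[]"])
    then show "S \<noteq> {}" by blast
    fix x y assume "x \<in> S" "y \<in> S"
    then obtain cs ds where cs: "set cs \<subseteq> C" "x = strip cs b" and ds: "set ds \<subseteq> C" "y = strip ds b"
      by (auto simp: S_def)
    have sub: "set cs \<subseteq> B" "set ds \<subseteq> B" using cs ds C by auto
    \<comment> \<open>Either list may be applied first, so the concatenation lies below both
      remainders.\<close>
    have "strip (cs @ ds) b \<preceq> x" "strip (cs @ ds) b \<preceq> y"
      using cs ds b sub strip_below strip_commute[OF sub, of b] by (metis strip_append)+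
    moreover have "strip (cs @ ds) b \<in> S"
      using cs ds by (auto simp: S_def intro!: exI[of _ "cs @ ds"])
    ultimately show "\<exists>c\<in>S. c \<preceq> x \<and> c \<preceq> y" by blast
  qed
  have "0 \<notin> up_closure S"
    using neg that below_zero by (fastforce simp: up_closure_def S_def)
  then obtain U where U: "U \<in> UF" "up_closure S \<subseteq> U" using ex_ultrafilter filt by blast
  then have SU: "S \<subseteq> U" using subset_up_closure[OF S] by blast
  have "strip [] b \<in> U" using SU unfolding S_def by (auto simp del: strip_Nil intro!: exI[of _ "[]"])
  then have "b \<in> U" by simp
  then obtain c where c: "c \<in> U" "c \<in> C" using cover U by blast
  have cB: "c \<in> B" using c C by auto
  have "strip [c] b \<in> U" using SU c unfolding S_def by (auto intro!: exI[of _ "[c]"])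
  then have *: "b - meet b c \<in> U" by (simp add: strip_Cons)
  have "meet (b - meet b c) c = 0"
    using b cB by (simp add: meet_diff meet_assoc meet_absorb below_refl)
  then show False using uf_meet_iff[OF U(1) uf_in_B[OF U(1) *] cB] * c uf_zero[OF U(1)] by simp
qed

section \<open>Extended characteristic functions\<close>

text \<open>The value at \<open>U\<close> of the extended characteristic function is the coefficient \<open>k\<close>
  by which \<open>a\<close> acts below all sufficiently small members of \<open>U\<close>.\<close>

definition germ :: "'a set \<Rightarrow> 'a \<Rightarrow> 'k \<Rightarrow> bool" where
  "germ U a k \<longleftrightarrow> (\<exists>u\<in>U. \<forall>v. v \<preceq> u \<longrightarrow> meet a v = lscale k v)"

lemma germ_unique:
  assumes U: "U \<in> UF" and "germ U a k" "germ U a l"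
  shows "k = l"
proof -
  obtain u v where uv: "u \<in> U" "\<forall>w. w \<preceq> u \<longrightarrow> meet a w = lscale k w"
    "v \<in> U" "\<forall>w. w \<preceq> v \<longrightarrow> meet a w = lscale l w"
    using assms by (auto simp: germ_def)
  obtain w where w: "w \<in> U" "w \<preceq> u" "w \<preceq> v" using uf_directed[OF U uv(1,3)] .
  then have "lscale (k - l) w = 0" using uv by (metis lscale_diff_left right_minus_eq)
  then show ?thesis using w uf_zero[OF U] uf_in_B[OF U] torsion_free by (metis right_minus_eq)
qed

lemma germ_add:
  assumes U: "U \<in> UF" and "germ U a k" "germ U b l"
  shows "germ U (a + b) (k + l)"
proof -
  obtain u v where uv: "u \<in> U" "\<forall>w. w \<preceq> u \<longrightarrow> meet a w = lscale k w"
    "v \<in> U" "\<forall>w. w \<preceq> v \<longrightarrow> meet b w = lscale l w"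
    using assms by (auto simp: germ_def)
  obtain w where w: "w \<in> U" "w \<preceq> u" "w \<preceq> v" using uf_directed[OF U uv(1,3)] .
  have "meet (a + b) x = lscale (k + l) x" if "x \<preceq> w" for x
  proof -
    have "x \<in> B" using that w uf_in_B[OF U] below_in_B by blast
    then show ?thesis using that w uv below_trans by (simp add: meet_add lscale_add_left)
  qed
  then show ?thesis using w by (auto simp: germ_def)
qed

lemma germ_lscale: "U \<in> UF \<Longrightarrow> germ U a k \<Longrightarrow> germ U (lscale l a) (l * k)"
  unfolding germ_def by (metis below_in_B lscale_assoc meet_lscale uf_in_B)

lemma germ_rscale: "U \<in> UF \<Longrightarrow> germ U a k \<Longrightarrow> germ U (rscale a l) (k * l)"
  unfolding germ_def by (metis below_in_B meet_rscale rscale_lscale uf_in_B)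

lemma germ_zero: "U \<in> UF \<Longrightarrow> germ U 0 0"
  unfolding germ_def using uf_nonempty uf_in_B below_in_B by fastforce

lemma germ_base:
  assumes U: "U \<in> UF" and b: "b \<in> B"
  shows "germ U b (if b \<in> U then 1 else 0)"
proof (cases "b \<in> U")
  case True
  moreover have "meet b v = lscale 1 v" if "v \<preceq> b" for v
    using that b below_in_B meet_absorb by (simp add: lscale_one)
  ultimately show ?thesis by (auto simp: germ_def)
next
  case False
  obtain u where u: "u \<in> U" "meet u b = 0" using uf_separate[OF U b False] .
  have "meet b v = 0" if "v \<preceq> u" for v
  proof -
    have B: "v \<in> B" "u \<in> B" using that u uf_in_B[OF U] below_in_B by auto
    then have "meet v b \<preceq> meet u b" using that b by (intro meet_mono) (auto intro: below_refl)
    then show ?thesis using u B b below_zero meet_commute by metis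
  qed
  then show ?thesis using u False by (auto simp: germ_def)
qed

lemma germ_exists: "U \<in> UF \<Longrightarrow> \<exists>k. germ U a k"
  by (induction a rule: span_induct) (meson germ_zero germ_add germ_base germ_lscale)+

abbreviation "chi \<equiv> char_ext lscale rscale B"

lemma char_ext_unique:
  assumes "is_char_ext lscale rscale B U \<phi>" "is_char_ext lscale rscale B U \<psi>"
  shows "\<phi> = \<psi>"
proof
  fix a
  have z: "f 0 = 0" if "is_char_ext lscale rscale B U f" for f
  proof -
    have "f (0 + 0) = f 0 + f 0"
      using that unfolding is_char_ext_def bimodule_linear_def by blast
    then show ?thesis by simp
  qed
  show "\<phi> a = \<psi> a"
    using assms z[OF assms(1)] z[OF assms(2)] by (induction a rule: span_induct) (auto simp: is_char_ext_def bimodule_linear_def)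
qed

text \<open>Uniqueness of germs turns their closure under the linear operations into equations for
  \<open>\<phi>\<close>.\<close>

lemma is_char_ext_germ:
  assumes U: "U \<in> UF" and \<phi>: "\<And>a. germ U a (\<phi> a)"
  shows "is_char_ext lscale rscale B U \<phi>"
  unfolding is_char_ext_def bimodule_linear_def
  using germ_unique[OF U \<phi>] germ_add[OF U \<phi> \<phi>] germ_lscale[OF U \<phi>] germ_rscale[OF U \<phi>]
    germ_base[OF U] by blast

lemma ex1_char_ext: "U \<in> UF \<Longrightarrow> \<exists>!\<phi>. is_char_ext lscale rscale B U \<phi>"
proof -
  assume U: "U \<in> UF"
  then have "\<forall>a. \<exists>k. germ U a k" using germ_exists by blast
  then obtain \<phi> where "\<And>a. germ U a (\<phi> a)" by metis
  then show ?thesis using is_char_ext_germ[OF U] char_ext_unique by blast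
qed

lemma chi_is_char_ext: "U \<in> UF \<Longrightarrow> is_char_ext lscale rscale B U (chi U)"
  unfolding char_ext_def by (rule theI'[OF ex1_char_ext])

lemma chi_add: "U \<in> UF \<Longrightarrow> chi U (a + b) = chi U a + chi U b"
  and chi_lscale: "U \<in> UF \<Longrightarrow> chi U (lscale k a) = k * chi U a"
  and chi_rscale: "U \<in> UF \<Longrightarrow> chi U (rscale a k) = chi U a * k"
  and chi_base: "U \<in> UF \<Longrightarrow> b \<in> B \<Longrightarrow> chi U b = (if b \<in> U then 1 else 0)"
  using chi_is_char_ext unfolding is_char_ext_def bimodule_linear_def by blast+

lemma chi_zero: "U \<in> UF \<Longrightarrow> chi U 0 = 0"
  using chi_add[of U 0 0] by simp

lemma chi_diff: "U \<in> UF \<Longrightarrow> chi U (a - b) = chi U a - chi U b"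
  using chi_add[of U "a - b" b] by simp

text \<open>A choice of germs extends the characteristic function, so uniqueness of the extension
  identifies it with \<open>chi U\<close>, which is only given by description.\<close>

lemma germ_chi: "U \<in> UF \<Longrightarrow> germ U a (chi U a)"
proof -
  assume U: "U \<in> UF"
  then have "\<forall>a. \<exists>k. germ U a k" using germ_exists by blast
  then obtain \<phi> where \<phi>: "\<And>a. germ U a (\<phi> a)" by metis
  then have "\<phi> = chi U"
    by (rule char_ext_unique[OF is_char_ext_germ[OF U] chi_is_char_ext[OF U]])
  with \<phi> show ?thesis by simp
qed

text \<open>Taking meets with \<open>b\<close> corresponds to multiplying a function by the
  indicator of a basic open set.\<close>

lemma chi_meet: "U \<in> UF \<Longrightarrow> b \<in> B \<Longrightarrow> chi U (meet a b) = (if b \<in> U then chi U a else 0)"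
  by (induction a rule: span_induct)
    (auto simp: chi_zero meet_add meet_lscale chi_add chi_lscale chi_base uf_meet_iff)

text \<open>The member \<open>u\<close> witnessing the germ at \<open>U\<close> witnesses the same
  germ at every ultrafilter containing \<open>u\<close>.\<close>

lemma chi_locally_constant:
  assumes U: "U \<in> UF"
  obtains u where "u \<in> U" "\<And>V. V \<in> UF \<Longrightarrow> u \<in> V \<Longrightarrow> chi V a = chi U a"
proof -
  obtain u where u: "u \<in> U" "\<forall>v. v \<preceq> u \<longrightarrow> meet a v = lscale (chi U a) v"
    using germ_chi[OF U, of a] by (auto simp: germ_def)
  have "chi V a = chi U a" if V: "V \<in> UF" "u \<in> V" for V
    by (rule germ_unique[OF V(1) germ_chi[OF V(1)]]) (use u V in \<open>auto simp: germ_def\<close>)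
  with u that show ?thesis by blast
qed

text \<open>\<open>D\<close> collects the elements of \<open>B\<close> that occur in an expression
  of \<open>a\<close> as a linear combination.\<close>

lemma chi_finite_support: "\<exists>D. finite D \<and> D \<subseteq> B \<and> (\<forall>U\<in>UF. chi U a \<noteq> 0 \<longrightarrow> U \<inter> D \<noteq> {})"
proof (induction a rule: span_induct)
  case zero
  show ?case by (rule exI[of _ "{}"]) (simp add: chi_zero)
next
  case (add x b k)
  then obtain D where "finite D" "D \<subseteq> B" "\<forall>U\<in>UF. chi U x \<noteq> 0 \<longrightarrow> U \<inter> D \<noteq> {}" by blast
  then show ?case using add
    by (intro exI[of _ "insert b D"]) (auto simp: chi_add chi_lscale chi_base split: if_splits)
qed

text \<open>The elements below which \<open>a\<close> vanishes meet every ultrafilter, so finitely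
  many of them strip any \<open>b\<close> to zero.\<close>

lemma eq_zero_if_chi_zero:
  assumes "\<And>U. U \<in> UF \<Longrightarrow> chi U a = 0"
  shows "a = 0"
proof (rule eq_zero_if_meets_zero)
  fix b assume b: "b \<in> B"
  define C where "C = {c \<in> B. \<forall>v. v \<preceq> c \<longrightarrow> meet a v = 0}"
  have "U \<inter> C \<noteq> {}" if U: "U \<in> UF" for U
  proof -
    obtain u where "u \<in> U" "\<forall>v. v \<preceq> u \<longrightarrow> meet a v = lscale 0 v"
      using germ_chi[OF U, of a] assms[OF U] by (auto simp: germ_def)
    then show ?thesis using uf_in_B[OF U] by (auto simp: C_def)
  qed
  moreover have "C \<subseteq> B" by (auto simp: C_def)
  ultimately obtain cs where cs: "set cs \<subseteq> C" "strip cs b = 0"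
    using finite_cover_strip[OF b] by metis
  \<comment> \<open>Each stripping step removes a piece below a member of \<open>C\<close>, where
    meets with \<open>a\<close> vanish.\<close>
  have "meet a (strip cs x) = meet a x" if "x \<in> B" for x
    using cs(1) that
  proof (induction cs arbitrary: x)
    case (Cons c cs)
    have c: "c \<in> B" "meet a (meet x c) = 0" "meet x c \<preceq> x"
      using Cons.prems meet_below2 meet_below1 by (auto simp: C_def)
    then have "meet a (x - meet x c) = meet a x"
      using Cons.prems by (simp add: meet_diff_right)
    moreover have "x - meet x c \<in> B" using c Cons.prems diff_in_B by blast
    ultimately show ?case using Cons by (simp add: strip_Cons)
  qed simp
  then show "meet a b = 0" using b cs meet_zero_right by metis
qed

text \<open>Primeness of ultrafilters: a member \<open>u\<close> below \<open>x\<close> and disjoint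
  from \<open>y\<close> satisfies \<open>u \<and> (x - y) = u\<close>.\<close>

lemma uf_diff:
  assumes U: "U \<in> UF" and "y \<preceq> x" "x \<in> U" "y \<notin> U"
  shows "x - y \<in> U"
proof -
  have B: "x \<in> B" "y \<in> B" "x - y \<in> B"
    using assms uf_in_B below_in_B diff_in_B by blast+
  obtain u where u: "u \<in> U" "u \<preceq> x" "meet u y = 0"
    using uf_separate_below[OF U B(2) assms(4,3)] .
  have uB: "u \<in> B" using u uf_in_B[OF U] by blast
  have "meet u x = u" using u uB B meet_commute meet_absorb by metis
  then have "meet u (x - y) = u" using u assms(2) B by (simp add: meet_diff_right)
  then show ?thesis using u uB B U uf_meet_iff by metis
qed

lemma uf_strip:
  assumes U: "U \<in> UF"
  shows "set cs \<subseteq> B \<Longrightarrow> set cs \<inter> U = {} \<Longrightarrow> x \<in> U \<Longrightarrow> strip cs x \<in> U"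
proof (induction cs arbitrary: x)
  case (Cons c cs)
  have x: "x \<in> B" using Cons.prems uf_in_B[OF U] by blast
  then have "meet x c \<notin> U" using Cons.prems uf_meet_iff[OF U, of x c] by simp
  then have "x - meet x c \<in> U" using uf_diff[OF U] Cons.prems x meet_below1 by simp
  then show ?case using Cons by (simp add: strip_Cons)
qed simp

section \<open>Bijectivity onto the locally constant functions\<close>

abbreviation "TOP \<equiv> ultrafilter_topology B P"

abbreviation basic :: "'a \<Rightarrow> 'a set set" where
  "basic b \<equiv> {U \<in> UF. b \<in> U}"

lemma openin_basic: "b \<in> B \<Longrightarrow> openin TOP (basic b)"
  unfolding ultrafilter_topology_def by (rule topology_generated_by_Basis) blast

lemma topspace_TOP: "topspace TOP = UF"
  unfolding ultrafilter_topology_def topology_generated_by_topspace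
  using uf_nonempty uf_in_B by blast

text \<open>The generating sets form a basis because \<open>basic (meet b c)\<close> is the
  intersection of \<open>basic b\<close> and \<open>basic c\<close>.\<close>

lemma openin_TOP_basic:
  assumes "openin TOP S" "U \<in> S"
  obtains b where "b \<in> U" "b \<in> B" "basic b \<subseteq> S"
proof -
  have "generate_topology_on (basic ` B) S"
    using assms by (simp add: ultrafilter_topology_def openin_topology_generated_by_iff)
  then have "U \<in> S \<longrightarrow> (\<exists>b\<in>U. b \<in> B \<and> basic b \<subseteq> S)"
  proof (induction rule: generate_topology_on.induct)
    case (Int S T)
    show ?case
    proof
      assume "U \<in> S \<inter> T"
      then obtain b c where bc: "b \<in> U" "b \<in> B" "basic b \<subseteq> S" "c \<in> U" "c \<in> B" "basic c \<subseteq> T"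
        using Int by blast
      moreover have U: "U \<in> UF"
        using \<open>U \<in> S \<inter> T\<close> openin_subset[of TOP S] Int.hyps(1) topspace_TOP
        by (auto simp: ultrafilter_topology_def openin_topology_generated_by_iff)
      ultimately have "meet b c \<in> U" "meet b c \<in> B" using uf_meet_iff by auto
      moreover have "basic (meet b c) \<subseteq> S \<inter> T" using bc uf_meet_iff by auto
      ultimately show "\<exists>b\<in>U. b \<in> B \<and> basic b \<subseteq> S \<inter> T" by blast
    qed
  next
    case (UN K)
    then show ?case by (meson Union_iff Union_upper order_trans)
  qed auto
  then show ?thesis using assms that by blast
qed

lemma compactin_basic:
  assumes b: "b \<in> B"
  shows "compactin TOP (basic b)"
  unfolding compactin_def
proof (intro conjI allI impI)
  show "basic b \<subseteq> topspace TOP" by (auto simp: topspace_TOP)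
  fix \<U> assume \<U>: "Ball \<U> (openin TOP) \<and> basic b \<subseteq> \<Union>\<U>"
  define C where "C = {c \<in> B. \<exists>S\<in>\<U>. basic c \<subseteq> S}"
  have "U \<inter> C \<noteq> {}" if "U \<in> UF" "b \<in> U" for U
  proof -
    have "U \<in> \<Union>\<U>" using \<U> that by blast
    then obtain S where S: "S \<in> \<U>" "U \<in> S" by blast
    then obtain c where "c \<in> U" "c \<in> B" "basic c \<subseteq> S" using \<U> openin_TOP_basic by blast
    then show ?thesis using S by (auto simp: C_def)
  qed
  moreover have "C \<subseteq> B" by (auto simp: C_def)
  ultimately obtain cs where cs: "set cs \<subseteq> C" "strip cs b = 0"
    using finite_cover_strip[OF b] by metis
  then have csB: "set cs \<subseteq> B" by (auto simp: C_def)
  have "\<forall>c\<in>set cs. \<exists>S\<in>\<U>. basic c \<subseteq> S" using cs by (auto simp: C_def)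
  then obtain S where S: "\<And>c. c \<in> set cs \<Longrightarrow> S c \<in> \<U> \<and> basic c \<subseteq> S c" by metis
  have "basic b \<subseteq> \<Union>(S ` set cs)"
  proof
    fix U assume U: "U \<in> basic b"
    \<comment> \<open>An ultrafilter containing \<open>b\<close> and avoiding \<open>cs\<close>
      would contain \<open>strip cs b = 0\<close>.\<close>
    then have "set cs \<inter> U \<noteq> {}" using uf_strip[OF _ csB] cs uf_zero by force
    then show "U \<in> \<Union>(S ` set cs)" using S U by blast
  qed
  then show "\<exists>\<F>. finite \<F> \<and> \<F> \<subseteq> \<U> \<and> basic b \<subseteq> \<Union>\<F>"
    using S by (intro exI[of _ "S ` set cs"]) auto
qed

section \<open>Range, injectivity and surjectivity of the map\<close>

abbreviation "hatB \<equiv> hat lscale rscale B P"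

lemma hat_apply: "U \<in> UF \<Longrightarrow> hatB a U = chi U a"
  by (simp add: hat_def)

lemma hat_in_KU: "hatB a \<in> KU B P"
proof -
  have "openin TOP {U \<in> topspace TOP. hatB a U \<in> S}" for S
  proof (subst openin_subopen, intro ballI)
    fix U assume "U \<in> {U \<in> topspace TOP. hatB a U \<in> S}"
    then have U: "U \<in> UF" "chi U a \<in> S" by (auto simp: topspace_TOP hat_apply)
    obtain u where u: "u \<in> U" "\<And>V. V \<in> UF \<Longrightarrow> u \<in> V \<Longrightarrow> chi V a = chi U a"
      using chi_locally_constant[OF U(1), of a] by blast
    show "\<exists>T. openin TOP T \<and> U \<in> T \<and> T \<subseteq> {U \<in> topspace TOP. hatB a U \<in> S}"
    proof (intro exI conjI)
      show "openin TOP (basic u)" using openin_basic uf_in_B[OF U(1) u(1)] .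
      show "U \<in> basic u" using U u(1) by simp
      show "basic u \<subseteq> {U \<in> topspace TOP. hatB a U \<in> S}"
      proof
        fix V assume "V \<in> basic u"
        moreover from this have "chi V a = chi U a" using u(2) by blast
        ultimately show "V \<in> {U \<in> topspace TOP. hatB a U \<in> S}"
          using U(2) by (simp add: topspace_TOP hat_apply)
      qed
    qed
  qed
  then have cont: "continuous_map TOP (discrete_topology UNIV) (hatB a)"
    by (simp add: continuous_map_def)
  obtain D where D: "finite D" "D \<subseteq> B" "\<forall>U\<in>UF. chi U a \<noteq> 0 \<longrightarrow> U \<inter> D \<noteq> {}"
    using chi_finite_support[of a] by metis
  have "compactin TOP (\<Union>(basic ` D))"
    using D compactin_basic by (intro compactin_Union) auto
  moreover have "{U \<in> UF. hatB a U \<noteq> 0} \<subseteq> \<Union>(basic ` D)"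
    using D by (auto simp: hat_apply)
  ultimately have "\<exists>C. compactin TOP C \<and> {U \<in> UF. hatB a U \<noteq> 0} \<subseteq> C" by blast
  moreover have "hatB a \<in> extensional UF" by (simp add: hat_def)
  ultimately show ?thesis using cont by (simp add: KU_def)
qed

lemma inj_hat: "inj hatB"
proof
  fix a b assume eq: "hatB a = hatB b"
  have "chi U (a - b) = 0" if "U \<in> UF" for U
    using that fun_cong[OF eq, of U] by (simp add: chi_diff hat_apply)
  then show "a = b" using eq_zero_if_chi_zero[of "a - b"] by simp
qed

lemma chi_realize:
  assumes "finite D" "D \<subseteq> B" "\<And>d. d \<in> D \<Longrightarrow> \<exists>k. \<forall>U\<in>basic d. f U = k"
  shows "\<exists>a. \<forall>U\<in>UF. chi U a = (if U \<inter> D = {} then 0 else f U)"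
  using assms
proof (induction D rule: finite_induct)
  case empty
  show ?case using chi_zero by auto
next
  case (insert d D)
  then obtain a where a: "\<forall>U\<in>UF. chi U a = (if U \<inter> D = {} then 0 else f U)" by auto
  obtain k where k: "\<forall>U\<in>basic d. f U = k" using insert.prems(2) by blast
  \<comment> \<open>Subtracting \<open>meet a d\<close> erases the values of \<open>a\<close> on
    \<open>basic d\<close> before \<open>k\<close> is put there, so overlaps with earlier members
    are not counted twice.\<close>
  have "chi U (a + lscale k d - meet a d) = (if U \<inter> insert d D = {} then 0 else f U)"
    if "U \<in> UF" for U
    using that a k insert.prems(1)
    by (auto simp: chi_diff chi_add chi_lscale chi_base chi_meet)
  then show ?case by blast
qed

lemma surj_hat:
  assumes "f \<in> KU B P"
  obtains a where "f = hatB a"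
proof -
  have ext: "f \<in> extensional UF" and cont: "continuous_map TOP (discrete_topology UNIV) f"
    using assms by (auto simp: KU_def)
  obtain C where C: "compactin TOP C" "{U \<in> UF. f U \<noteq> 0} \<subseteq> C"
    using assms by (auto simp: KU_def)
  \<comment> \<open>By continuity every point of \<open>C\<close> lies in \<open>basic b\<close> for
    some \<open>b\<close> in \<open>G\<close>, and compactness leaves finitely many such
    \<open>b\<close>. Outside their basic sets \<open>f\<close> vanishes.\<close>
  define G where "G = {b \<in> B. \<exists>k. \<forall>U\<in>basic b. f U = k}"
  have "C \<subseteq> \<Union>(basic ` G)"
  proof
    fix U assume "U \<in> C"
    then have U: "U \<in> UF" using compactin_subset_topspace[OF C(1)] topspace_TOP by auto
    have "openin TOP {V \<in> topspace TOP. f V \<in> {f U}}"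
      using cont by (rule openin_continuous_map_preimage) simp
    then obtain b where "b \<in> U" "b \<in> B" "basic b \<subseteq> {V \<in> topspace TOP. f V \<in> {f U}}"
      using U openin_TOP_basic topspace_TOP by (smt (verit) insertI1 mem_Collect_eq)
    then show "U \<in> \<Union>(basic ` G)" using U by (auto simp: G_def)
  qed
  moreover have "openin TOP S" if "S \<in> basic ` G" for S
    using that openin_basic by (auto simp: G_def)
  ultimately have "\<exists>\<F>. finite \<F> \<and> \<F> \<subseteq> basic ` G \<and> C \<subseteq> \<Union>\<F>"
    by (intro compactinD[OF C(1)])
  then obtain \<F> where \<F>: "finite \<F>" "\<F> \<subseteq> basic ` G" "C \<subseteq> \<Union>\<F>"
    by blast
  obtain D where D: "D \<subseteq> G" "finite D" "\<F> = basic ` D"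
    using finite_subset_image[OF \<F>(1,2)] by blast
  then obtain a where a: "\<forall>U\<in>UF. chi U a = (if U \<inter> D = {} then 0 else f U)"
    using chi_realize[of D f] by (auto simp: G_def)
  have "f U = hatB a U" for U
  proof (cases "U \<in> UF")
    case True
    have "f U = 0" if "U \<inter> D = {}"
      using that C \<F> D True by blast
    then show ?thesis using a True by (simp add: hat_apply)
  next
    case False
    then show ?thesis using ext by (simp add: hat_def extensional_def)
  qed
  then show ?thesis using that by blast
qed

lemma bij_betw_hat: "bij_betw hatB UNIV (KU B P)"
  using inj_hat hat_in_KU surj_hat unfolding bij_betw_def by blast

section \<open>Factorizations of ultrafilters and convolution\<close>

definition src :: "'a set \<Rightarrow> 'a set" where
  "src U = {p \<in> P. \<exists>u\<in>U. u * p = u}"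

text \<open>Unlike \<open>src U\<close>, this set may be empty, as elements of \<open>B\<close> need not have a left unit in \<open>P\<close>.\<close>

definition tgt :: "'a set \<Rightarrow> 'a set" where
  "tgt U = {p \<in> P. \<exists>u\<in>U. p * u = u}"

text \<open>Any single member \<open>b\<close> tests membership: a common lower bound of
  \<open>b\<close> and a member fixed by \<open>p\<close> is itself fixed by \<open>p\<close>, hence
  lies below \<open>b * p\<close>.\<close>

lemma src_iff:
  assumes U: "U \<in> UF" and b: "b \<in> U" and p: "p \<in> P"
  shows "p \<in> src U \<longleftrightarrow> b * p \<in> U"
proof
  assume "p \<in> src U"
  then obtain u where u: "u \<in> U" "u * p = u" by (auto simp: src_def)
  obtain v where v: "v \<in> U" "v \<preceq> u" "v \<preceq> b" using uf_directed[OF U u(1) b] .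
  have "v * p = v" using below_mult_P_right[OF v(2) u(2) p] .
  then have "v \<preceq> b * p" using mult_P_mono[OF v(3) p] by simp
  then show "b * p \<in> U"
    using uf_up[OF U v(1)] B_mult P_in_B p uf_in_B[OF U b] by blast
next
  assume "b * p \<in> U"
  moreover have "b * p * p = b * p" using p P_idem by (simp add: mult.assoc)
  ultimately show "p \<in> src U" using p by (auto simp: src_def)
qed

lemma tgt_iff:
  assumes U: "U \<in> UF" and b: "b \<in> U" and p: "p \<in> P"
  shows "p \<in> tgt U \<longleftrightarrow> p * b \<in> U"
proof
  assume "p \<in> tgt U"
  then obtain u where u: "u \<in> U" "p * u = u" by (auto simp: tgt_def)
  obtain v where v: "v \<in> U" "v \<preceq> u" "v \<preceq> b" using uf_directed[OF U u(1) b] .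
  have "p * v = v" using below_mult_P_left[OF v(2) u(2)] .
  then have "v \<preceq> p * b" using mult_left_mono_below[OF v(3), of p] by simp
  then show "p * b \<in> U"
    using uf_up[OF U v(1)] B_mult P_in_B p uf_in_B[OF U b] by blast
next
  assume "p * b \<in> U"
  moreover have "p * (p * b) = p * b" using p P_idem by (simp add: mult.assoc[symmetric])
  ultimately show "p \<in> tgt U" using p by (auto simp: tgt_def)
qed

text \<open>Products are the meets in \<open>P\<close>. As \<open>P\<close> need not have a greatest
  element, primeness uses complements relative to members of \<open>E\<close>.\<close>

definition prime_filter :: "'a set \<Rightarrow> bool" where
  "prime_filter E \<longleftrightarrow> E \<subseteq> P \<and> E \<noteq> {} \<and> 0 \<notin> E \<and>
     (\<forall>p\<in>E. \<forall>q\<in>E. p * q \<in> E) \<and>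
     (\<forall>p\<in>P. \<forall>q\<in>P. p * q \<in> E \<longrightarrow> q \<in> E) \<and>
     (\<forall>q\<in>E. \<forall>p\<in>P. q * p \<in> E \<or> q - q * p \<in> E)"

lemma diff_mult_zero: "p \<in> P \<Longrightarrow> (q - q * p) * p = 0"
  using P_idem by (simp add: left_diff_distrib mult.assoc)

text \<open>Prime filters are maximal: \<open>p\<close> in \<open>F\<close> rules out
  \<open>q - q * p\<close> in \<open>E\<close>, as their product is \<open>0\<close>. Later
  equalities of such filters thus need only one inclusion.\<close>

lemma prime_filter_eq:
  assumes E: "prime_filter E" and F: "prime_filter F" and sub: "E \<subseteq> F"
  shows "E = F"
proof (rule subset_antisym[OF sub], rule subsetI)
  fix p assume p: "p \<in> F"
  have pP: "p \<in> P" using p F by (auto simp: prime_filter_def)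
  obtain q where q: "q \<in> E" "q \<in> P" using E by (auto simp: prime_filter_def)
  have "q - q * p \<notin> E"
  proof
    assume "q - q * p \<in> E"
    then have "(q - q * p) * p \<in> F" using p F sub by (auto simp: prime_filter_def)
    then show False using F diff_mult_zero[OF pP] by (auto simp: prime_filter_def)
  qed
  then show "p \<in> E" using E q pP unfolding prime_filter_def by blast
qed

text \<open>For a fixed \<open>b\<close> in \<open>U\<close>, \<open>src_iff\<close> reduces every
  condition to a property of the ultrafilter; primeness becomes \<open>uf_diff\<close>.\<close>

lemma prime_filter_src:
  assumes U: "U \<in> UF"
  shows "prime_filter (src U)"
proof -
  obtain b where b: "b \<in> U" using uf_nonempty[OF U] by blast
  have bB: "b \<in> B" using uf_in_B[OF U b] .
  obtain s where s: "s \<in> P" "b * s = b" using right_unit_exists[OF bB] .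
  have iff: "p \<in> src U \<longleftrightarrow> p \<in> P \<and> b * p \<in> U" for p
    using src_iff[OF U b] by (auto simp: src_def)
  have mult: "b * (p * q) \<in> U" if "p \<in> src U" "q \<in> src U" for p q
  proof -
    have "b * p \<in> U" "q \<in> P" using that iff by auto
    then show ?thesis using src_iff[OF U, of "b * p" q] that by (simp add: mult.assoc)
  qed
  have up: "b * q \<in> U" if "p \<in> P" "q \<in> P" "b * (p * q) \<in> U" for p q
  proof -
    have "b * (p * q) \<preceq> b * q" using that P_commute mult_P_below by (metis mult.assoc)
    then show ?thesis using uf_up[OF U that(3)] B_mult bB P_in_B that by blast
  qed
  have prime: "b * (q * p) \<in> U \<or> b * (q - q * p) \<in> U" if "q \<in> src U" "p \<in> P" for p q
    using uf_diff[OF U, of "b * (q * p)" "b * q"] that iff mult_P_below[of p "b * q"]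
    by (auto simp: mult.assoc right_diff_distrib)
  show ?thesis
    unfolding prime_filter_def
  proof (intro conjI ballI impI)
    show "src U \<noteq> {}" using s b iff by force
    show "0 \<notin> src U" using uf_zero[OF U] iff[of 0] by simp
    show "p * q \<in> src U" if "p \<in> src U" "q \<in> src U" for p q
      using that mult[OF that] P_mult iff by blast
    show "q \<in> src U" if "p \<in> P" "q \<in> P" "p * q \<in> src U" for p q
      using that up iff by blast
    show "q * p \<in> src U \<or> q - q * p \<in> src U" if "q \<in> src U" "p \<in> P" for p q
      using that prime[OF that] P_mult diff_in_P iff by blast
  qed (use iff in blast)
qed

lemma prime_filter_tgt:
  assumes U: "U \<in> UF" and ne: "tgt U \<noteq> {}"
  shows "prime_filter (tgt U)"
proof -
  obtain b where b: "b \<in> U" using uf_nonempty[OF U] by blast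
  have bB: "b \<in> B" using uf_in_B[OF U b] .
  have iff: "p \<in> tgt U \<longleftrightarrow> p \<in> P \<and> p * b \<in> U" for p
    using tgt_iff[OF U b] by (auto simp: tgt_def)
  have mult: "p * q * b \<in> U" if "p \<in> tgt U" "q \<in> tgt U" for p q
  proof -
    have "q * b \<in> U" "p \<in> P" using that iff by auto
    then show ?thesis using tgt_iff[OF U, of "q * b" p] that by (simp add: mult.assoc)
  qed
  have up: "q * b \<in> U" if "p \<in> P" "q \<in> P" "p * q * b \<in> U" for p q
  proof -
    have "p * q * b \<preceq> q * b" using that P_mult_below B_mult bB P_in_B by (simp add: mult.assoc)
    then show ?thesis using uf_up[OF U that(3)] B_mult bB P_in_B that by blast
  qed
  have prime: "q * p * b \<in> U \<or> (q - q * p) * b \<in> U" if q: "q \<in> tgt U" and p: "p \<in> P" for p q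
  proof -
    have "q \<in> P" "q * b \<in> U" using q iff by auto
    moreover have "q * p * b \<preceq> q * b"
      using P_mult_below[OF p, of "q * b"] uf_in_B[OF U] calculation P_commute[OF p, of q]
      by (simp add: mult.assoc[symmetric])
    ultimately show ?thesis using uf_diff[OF U] by (auto simp: left_diff_distrib)
  qed
  show ?thesis
    unfolding prime_filter_def
  proof (intro conjI ballI impI)
    show "tgt U \<noteq> {}" by (rule ne)
    show "0 \<notin> tgt U" using uf_zero[OF U] iff[of 0] by simp
    show "p * q \<in> tgt U" if "p \<in> tgt U" "q \<in> tgt U" for p q
      using that mult[OF that] P_mult iff by blast
    show "q \<in> tgt U" if "p \<in> P" "q \<in> P" "p * q \<in> tgt U" for p q
      using that up iff by blast
    show "q * p \<in> tgt U \<or> q - q * p \<in> tgt U" if "q \<in> tgt U" "p \<in> P" for p q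
      using that prime[OF that] P_mult diff_in_P iff by blast
  qed (use iff in blast)
qed

section \<open>Ultrafilters from one member and a prime filter\<close>

definition translate :: "'a \<Rightarrow> 'a set \<Rightarrow> 'a set" where
  "translate b E = up_closure ((\<lambda>p. b * p) ` E)"

text \<open>A common lower bound of \<open>b\<close> and another member has the form
  \<open>b * p\<close> with \<open>p\<close> in \<open>src U\<close>.\<close>

lemma uf_eq_translate:
  assumes U: "U \<in> UF" and b: "b \<in> U"
  shows "U = translate b (src U)"
proof
  have iff: "p \<in> src U \<longleftrightarrow> p \<in> P \<and> b * p \<in> U" for p
    using src_iff[OF U b] by (auto simp: src_def)
  show "translate b (src U) \<subseteq> U"
    using uf_up[OF U] by (auto simp: translate_def up_closure_def iff)
  show "U \<subseteq> translate b (src U)"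
  proof
    fix d assume d: "d \<in> U"
    obtain c where c: "c \<in> U" "c \<preceq> d" "c \<preceq> b" using uf_directed[OF U d b] .
    then obtain p where "p \<in> P" "c = b * p" by (auto simp: below_def)
    then show "d \<in> translate b (src U)"
      using c d uf_in_B[OF U] by (auto simp: translate_def up_closure_def iff)
  qed
qed

lemma translate_ultrafilter:
  assumes E: "prime_filter E" and b: "b \<in> B" and nz: "\<And>p. p \<in> E \<Longrightarrow> b * p \<noteq> 0"
  shows "translate b E \<in> UF" "b \<in> translate b E" "src (translate b E) = E"
proof -
  have EP: "p \<in> P" if "p \<in> E" for p using that E by (auto simp: prime_filter_def)
  have EB: "(\<lambda>p. b * p) ` E \<subseteq> B" using EP P_in_B B_mult b by auto
  obtain q where q: "q \<in> E" using E by (auto simp: prime_filter_def)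
  have filt: "is_filter B P (translate b E)"
    unfolding translate_def
  proof (rule is_filter_up_closure[OF EB])
    show "(\<lambda>p. b * p) ` E \<noteq> {}" using q by blast
    fix x y assume "x \<in> (\<lambda>p. b * p) ` E" "y \<in> (\<lambda>p. b * p) ` E"
    then obtain r t where rt: "r \<in> E" "t \<in> E" "x = b * r" "y = b * t" by blast
    then have "b * (r * t) \<preceq> x" "b * (r * t) \<preceq> y"
      using EP P_commute mult_P_below by (metis mult.assoc)+
    then show "\<exists>c\<in>(\<lambda>p. b * p) ` E. c \<preceq> x \<and> c \<preceq> y"
      using rt E by (auto simp: prime_filter_def)
  qed
  show bT: "b \<in> translate b E"
    using q b EP mult_P_below by (auto simp: translate_def up_closure_def)
  show T: "translate b E \<in> UF"
  proof (rule ufI[OF filt])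
    show "0 \<notin> translate b E"
      using nz below_zero by (fastforce simp: translate_def up_closure_def)
    fix G assume G: "is_filter B P G" "0 \<notin> G" "translate b E \<subseteq> G"
    show "G \<subseteq> translate b E"
    proof
      fix g assume g: "g \<in> G"
      obtain h where h: "h \<in> G" "h \<preceq> g" "h \<preceq> b"
        using filter_directed[OF G(1) g, of b] bT G(3) by blast
      then obtain p where p: "p \<in> P" "h = b * p" by (auto simp: below_def)
      \<comment> \<open>By primeness the alternative is \<open>q * p \<in> E\<close>, which puts
        \<open>g\<close> above \<open>b * (q * p)\<close>. Here a common lower bound
        \<open>d\<close> in \<open>G\<close> would satisfy \<open>d = d * p\<close> and lie below
        \<open>b * (q - q * p) * p = 0\<close>.\<close>
      have "q - q * p \<notin> E"
      proof
        assume r: "q - q * p \<in> E"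
        then have "b * (q - q * p) \<in> translate b E"
          using EB below_refl by (auto simp: translate_def up_closure_def)
        then obtain d where d: "d \<in> G" "d \<preceq> b * (q - q * p)" "d \<preceq> h"
          using filter_directed[OF G(1) _ h(1)] G(3) by blast
        have "h * p = h" using p P_idem by (simp add: mult.assoc)
        then have "d * p = d" using below_mult_P_right d(3) p(1) by blast
        then have "d \<preceq> b * (q - q * p) * p" using mult_P_mono[OF d(2) p(1)] by simp
        then show False
          using diff_mult_zero[OF p(1), of q] below_zero d(1) G(2)
          by (metis mult.assoc mult_zero_right)
      qed
      then have qp: "q * p \<in> E" using E q p unfolding prime_filter_def by blast
      have "b * (q * p) \<preceq> h" using p q EP P_commute mult_P_below by (metis mult.assoc)
      then have "b * (q * p) \<preceq> g" using h(2) below_trans by blast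
      then show "g \<in> translate b E"
        using qp filter_subset[OF G(1) g] by (auto simp: translate_def up_closure_def)
    qed
  qed
  have "E \<subseteq> src (translate b E)"
  proof
    fix p assume p: "p \<in> E"
    then have "b * p \<in> translate b E"
      using EB below_refl by (auto simp: translate_def up_closure_def)
    then show "p \<in> src (translate b E)" using src_iff[OF T bT EP[OF p]] by blast
  qed
  then show "src (translate b E) = E"
    using prime_filter_eq[OF E prime_filter_src[OF T]] by blast
qed

lemma src_uf_prod:
  assumes V: "V \<in> UF" and W: "W \<in> UF" and U: "uf_prod B P V W \<in> UF"
  shows "src (uf_prod B P V W) = src W"
proof -
  obtain v where v: "v \<in> V" using uf_nonempty[OF V] by blast
  have "src W \<subseteq> src (uf_prod B P V W)"
  proof
    fix p assume "p \<in> src W"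
    then obtain w where w: "p \<in> P" "w \<in> W" "w * p = w" by (auto simp: src_def)
    have "v * w \<in> B" using v w V W uf_in_B B_mult by blast
    then have "v * w \<in> uf_prod B P V W" using v w below_refl by (auto simp: uf_prod_def)
    moreover have "v * w * p = v * w" using w by (simp add: mult.assoc)
    ultimately show "p \<in> src (uf_prod B P V W)" using w unfolding src_def by blast
  qed
  then show ?thesis using prime_filter_eq prime_filter_src W U by metis
qed

text \<open>If \<open>p\<close> fixes \<open>v\<close> on the right but \<open>p * c\<close> is not
  in \<open>W\<close>, some \<open>w\<close> in \<open>W\<close> below \<open>c\<close> is disjoint
  from \<open>p * c\<close>. Then \<open>p * w\<close> lies below both and is zero, so
  \<open>v * w = v * p * w = 0\<close>, against composability.\<close>

lemma tgt_eq_src_if_composable: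
  assumes V: "V \<in> UF" and W: "W \<in> UF" and VW: "uf_composable V W"
  shows "tgt W = src V"
proof -
  obtain c where c: "c \<in> W" using uf_nonempty[OF W] by blast
  have cB: "c \<in> B" using uf_in_B[OF W c] .
  have sub: "src V \<subseteq> tgt W"
  proof
    fix p assume "p \<in> src V"
    then obtain v where v: "p \<in> P" "v \<in> V" "v * p = v" by (auto simp: src_def)
    have pcB: "p * c \<in> B" using v cB P_in_B B_mult by blast
    have "p * c \<in> W"
    proof (rule ccontr)
      assume "p * c \<notin> W"
      then obtain w where w: "w \<in> W" "w \<preceq> c" "meet w (p * c) = 0"
        using uf_separate_below[OF W pcB _ c] by blast
      have wB: "w \<in> B" using uf_in_B[OF W w(1)] .
      have "p * w \<preceq> w" "p * w \<preceq> p * c"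
        using P_mult_below[OF v(1) wB] mult_left_mono_below[OF w(2)] by auto
      then have "p * w = 0" using meet_greatest[OF wB pcB] w(3) below_zero by metis
      then have "v * w = 0" using v(3) by (metis mult.assoc mult_zero_right)
      then show False using VW v w by (auto simp: uf_composable_def)
    qed
    then show "p \<in> tgt W" using tgt_iff[OF W c v(1)] by blast
  qed
  have srcV: "prime_filter (src V)" using prime_filter_src[OF V] .
  then have "tgt W \<noteq> {}" using sub by (auto simp: prime_filter_def)
  then show ?thesis using prime_filter_eq[OF srcV prime_filter_tgt[OF W] sub] by blast
qed

section \<open>Factorizations through two given elements\<close>

definition factorizations :: "'a set \<Rightarrow> ('a set \<times> 'a set) set" where
  "factorizations U = {(V, W). V \<in> UF \<and> W \<in> UF \<and> uf_composable V W \<and> uf_prod B P V W = U}"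

text \<open>\<open>src W\<close> equals \<open>src U\<close>, so \<open>c\<close> determines
  \<open>W\<close>; then \<open>src V\<close> equals \<open>tgt W\<close>, so \<open>b\<close>
  determines \<open>V\<close>.\<close>

lemma factorization_unique:
  assumes U: "U \<in> UF" and "(V, W) \<in> factorizations U" "(V', W') \<in> factorizations U"
    and "b \<in> V" "b \<in> V'" "c \<in> W" "c \<in> W'"
  shows "V = V' \<and> W = W'"
proof -
  have uf: "V \<in> UF" "W \<in> UF" "V' \<in> UF" "W' \<in> UF"
    and comp: "uf_composable V W" "uf_composable V' W'"
    and prod: "uf_prod B P V W = U" "uf_prod B P V' W' = U"
    using assms by (auto simp: factorizations_def)
  have "src W = src W'" using src_uf_prod uf prod U by metis
  then have W: "W = W'" using uf_eq_translate uf assms by metis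
  then have "src V = src V'" using tgt_eq_src_if_composable uf comp by metis
  then have "V = V'" using uf_eq_translate uf assms by metis
  with W show ?thesis by simp
qed

lemma factorization_mem:
  assumes "(V, W) \<in> factorizations U" "b \<in> V" "c \<in> W"
  shows "b * c \<in> U"
proof -
  have "b * c \<in> B" using assms uf_in_B B_mult unfolding factorizations_def by blast
  then show ?thesis
    using assms below_refl unfolding factorizations_def uf_prod_def by blast
qed

text \<open>The uniqueness argument dictates the candidates: \<open>W\<close> is the translate of
  \<open>src U\<close> by \<open>c\<close>, and \<open>V\<close> the translate of
  \<open>tgt W\<close> by \<open>b\<close>.\<close>

lemma factorization_exists:
  assumes U: "U \<in> UF" and b: "b \<in> B" and c: "c \<in> B" and bc: "b * c \<in> U"
  obtains V W where "(V, W) \<in> factorizations U" "b \<in> V" "c \<in> W"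
proof -
  define E where "E = src U"
  have E: "prime_filter E" using prime_filter_src[OF U] by (simp add: E_def)
  have EP: "p \<in> P" if "p \<in> E" for p using that by (auto simp: E_def src_def)
  have bcE: "p \<in> E \<longleftrightarrow> b * (c * p) \<in> U" if "p \<in> P" for p
    using that src_iff[OF U bc] by (simp add: E_def mult.assoc)
  define W where "W = translate c E"
  have "c * p \<noteq> 0" if "p \<in> E" for p
    using that bcE[OF EP] uf_zero[OF U] by fastforce
  from translate_ultrafilter[OF E c this]
  have W: "W \<in> UF" "c \<in> W" "src W = E" by (auto simp: W_def)
  have W_below: "\<exists>q\<in>E. c * q \<preceq> w" if "w \<in> W" for w
    using that by (auto simp: W_def translate_def up_closure_def)
  \<comment> \<open>Nonemptiness of \<open>tgt W\<close> comes from a right unit \<open>s\<close> of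
    \<open>b\<close>: moving it past \<open>c\<close> gives \<open>q\<close> in
    \<open>src W\<close>, whence \<open>s * c\<close> is in \<open>W\<close>.\<close>
  obtain s where s: "s \<in> P" "b * s = b" using right_unit_exists[OF b] .
  obtain q where q: "q \<in> P" "s * c = c * q" using P_mult_below[OF s(1) c] by (auto simp: below_def)
  have "b * (c * q) = b * c" using s q by (metis mult.assoc)
  then have "q \<in> src W" using bcE[OF q(1)] bc W by simp
  then have "s * c \<in> W" using src_iff[OF W(1,2) q(1)] q by simp
  then have "tgt W \<noteq> {}" using tgt_iff[OF W(1,2) s(1)] by blast
  then have R: "prime_filter (tgt W)" using prime_filter_tgt[OF W(1)] by blast
  \<comment> \<open>\<open>p * w\<close> is again in \<open>W\<close>, so it lies above some
    \<open>c * r\<close> with \<open>r\<close> in \<open>src U\<close>, and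
    \<open>b * (c * r)\<close> is in \<open>U\<close>.\<close>
  have mem: "b * p * w \<in> U" if "p \<in> tgt W" "w \<in> W" for p w
  proof -
    have p: "p \<in> P" using that by (auto simp: tgt_def)
    then have "p * w \<in> W" using tgt_iff[OF W(1) that(2)] that(1) by blast
    then obtain r where r: "r \<in> E" "c * r \<preceq> p * w" using W_below by blast
    have "b * (c * r) \<in> U" using bcE EP r by blast
    moreover have "b * (c * r) \<preceq> b * (p * w)" using mult_left_mono_below r by blast
    ultimately show ?thesis
      using uf_up[OF U] B_mult b p P_in_B uf_in_B[OF W(1) that(2)] by (simp add: mult.assoc)
  qed
  define V where "V = translate b (tgt W)"
  have "b * p \<noteq> 0" if "p \<in> tgt W" for p
    using mem[OF that W(2)] uf_zero[OF U] by fastforce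
  from translate_ultrafilter[OF R b this]
  have V: "V \<in> UF" "b \<in> V" by (auto simp: V_def)
  have vw: "v * w \<in> U" if "v \<in> V" "w \<in> W" for v w
  proof -
    have B: "v \<in> B" "w \<in> B" using that V W uf_in_B by auto
    have "v \<in> translate b (tgt W)" using that(1) by (simp add: V_def)
    then obtain p where p: "p \<in> tgt W" "b * p \<preceq> v"
      by (auto simp: translate_def up_closure_def)
    have "b * p * w \<preceq> v * w" using mult_right_mono_below[OF p(2) B(2)] .
    then show ?thesis using mem[OF p(1) that(2)] uf_up[OF U] B B_mult by blast
  qed
  have "uf_composable V W" using vw uf_zero[OF U] unfolding uf_composable_def by metis
  moreover have "uf_prod B P V W = U"
  proof
    show "uf_prod B P V W \<subseteq> U" using vw uf_up[OF U] by (auto simp: uf_prod_def)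
    show "U \<subseteq> uf_prod B P V W"
    proof
      fix d assume d: "d \<in> U"
      then have "d \<in> translate (b * c) E" using uf_eq_translate[OF U bc] by (simp add: E_def)
      then obtain p where p: "p \<in> E" "b * (c * p) \<preceq> d"
        by (auto simp: translate_def up_closure_def mult.assoc)
      have "c * p \<in> W" using src_iff[OF W(1,2) EP[OF p(1)]] p W(3) by blast
      then show "d \<in> uf_prod B P V W"
        using p V(2) uf_in_B[OF U d] by (auto simp: uf_prod_def)
    qed
  qed
  ultimately show ?thesis using that V W by (auto simp: factorizations_def)
qed

section \<open>Convolution as a sum over factorizations\<close>

text \<open>The sum is over all large finite sets of factorizations rather than over the support of
  \<open>\<lambda>(V, W). chi V a * chi W b\<close>, as the support is not additive in \<open>a\<close> and \<open>b\<close>.\<close>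

definition convolves :: "'a set \<Rightarrow> 'a \<Rightarrow> 'a \<Rightarrow> bool" where
  "convolves U a b \<longleftrightarrow> (\<forall>\<^sub>F T in finite_subsets_at_top (factorizations U).
     (\<Sum>(V, W)\<in>T. chi V a * chi W b) = chi U (a * b))"

lemma eventually_factorizations:
  "\<forall>\<^sub>F T in finite_subsets_at_top (factorizations U). T \<subseteq> factorizations U"
  by (intro eventually_finite_subsets_at_top_weakI) auto

lemma factorizationsD: "(V, W) \<in> factorizations U \<Longrightarrow> V \<in> UF \<and> W \<in> UF"
  by (auto simp: factorizations_def)

lemma convolves_zero_left: "U \<in> UF \<Longrightarrow> convolves U 0 b"
  unfolding convolves_def
  by (intro eventually_finite_subsets_at_top_weakI)
    (auto intro!: sum.neutral simp: chi_zero factorizations_def)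

lemma convolves_zero_right: "U \<in> UF \<Longrightarrow> convolves U a 0"
  unfolding convolves_def
  by (intro eventually_finite_subsets_at_top_weakI)
    (auto intro!: sum.neutral simp: chi_zero factorizations_def)

lemma convolves_add_left:
  assumes U: "U \<in> UF" and "convolves U a c" "convolves U b c"
  shows "convolves U (a + b) c"
  using assms(2,3) eventually_factorizations[of U] unfolding convolves_def
proof eventually_elim
  case (elim T)
  have "(\<Sum>(V, W)\<in>T. chi V (a + b) * chi W c)
      = (\<Sum>(V, W)\<in>T. chi V a * chi W c) + (\<Sum>(V, W)\<in>T. chi V b * chi W c)"
    unfolding sum.distrib[symmetric] using elim(3)
    by (intro sum.cong) (auto simp: chi_add distrib_right dest!: factorizationsD)
  then show ?case using elim U by (simp add: chi_add distrib_right)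
qed

lemma convolves_add_right:
  assumes U: "U \<in> UF" and "convolves U c a" "convolves U c b"
  shows "convolves U c (a + b)"
  using assms(2,3) eventually_factorizations[of U] unfolding convolves_def
proof eventually_elim
  case (elim T)
  have "(\<Sum>(V, W)\<in>T. chi V c * chi W (a + b))
      = (\<Sum>(V, W)\<in>T. chi V c * chi W a) + (\<Sum>(V, W)\<in>T. chi V c * chi W b)"
    unfolding sum.distrib[symmetric] using elim(3)
    by (intro sum.cong) (auto simp: chi_add distrib_left dest!: factorizationsD)
  then show ?case using elim U by (simp add: chi_add distrib_left)
qed

text \<open>Only a factorization with \<open>b\<close> in \<open>V\<close> and \<open>c\<close> in
  \<open>W\<close> contributes; there is exactly one if \<open>b * c\<close> is in \<open>U\<close>,
  and none otherwise.\<close>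

lemma convolves_base:
  assumes U: "U \<in> UF" and b: "b \<in> B" and c: "c \<in> B"
  shows "convolves U (lscale k b) (lscale l c)"
proof -
  have summand: "chi V (lscale k b) * chi W (lscale l c) = (if b \<in> V \<and> c \<in> W then k * l else 0)"
    if "(V, W) \<in> factorizations U" for V W
    using factorizationsD[OF that] b c by (simp add: chi_lscale chi_base)
  have rhs: "chi U (lscale k b * lscale l c) = (if b * c \<in> U then k * l else 0)"
    using U b c B_mult by (simp add: lscale_mult_lscale chi_lscale chi_base)
  show ?thesis
  proof (cases "b * c \<in> U")
    case True
    obtain V W where VW: "(V, W) \<in> factorizations U" "b \<in> V" "c \<in> W"
      using factorization_exists[OF U b c True] .
    have "(\<Sum>(V, W)\<in>T. chi V (lscale k b) * chi W (lscale l c)) = k * l"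
      if T: "finite T" "{(V, W)} \<subseteq> T" "T \<subseteq> factorizations U" for T
    proof -
      have "(\<Sum>(V, W)\<in>T. chi V (lscale k b) * chi W (lscale l c))
          = (\<Sum>(V, W)\<in>{(V, W)}. chi V (lscale k b) * chi W (lscale l c))"
      proof (rule sum.mono_neutral_right[OF T(1,2)], rule ballI)
        fix x assume x: "x \<in> T - {(V, W)}"
        obtain V' W' where x_eq: "x = (V', W')" by fastforce
        have *: "(V', W') \<in> T" "(V', W') \<noteq> (V, W)" using x x_eq by auto
        then have fact: "(V', W') \<in> factorizations U" using T by blast
        then have "\<not> (b \<in> V' \<and> c \<in> W')"
          using * factorization_unique[OF U VW(1) fact VW(2) _ VW(3)] by blast
        then show "(case x of (V, W) \<Rightarrow> chi V (lscale k b) * chi W (lscale l c)) = 0"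
          by (simp only: x_eq prod.case summand[OF fact] if_False)
      qed
      then show ?thesis using summand[OF VW(1)] VW by simp
    qed
    then show ?thesis
      using VW(1) rhs True unfolding convolves_def eventually_finite_subsets_at_top
      by (intro exI[of _ "{(V, W)}"]) auto
  next
    case False
    have "(\<Sum>(V, W)\<in>T. chi V (lscale k b) * chi W (lscale l c)) = 0"
      if T: "T \<subseteq> factorizations U" for T
    proof (rule sum.neutral, clarify)
      fix V W assume "(V, W) \<in> T"
      then have fact: "(V, W) \<in> factorizations U" using T by blast
      then have "\<not> (b \<in> V \<and> c \<in> W)" using factorization_mem False by blast
      then show "chi V (lscale k b) * chi W (lscale l c) = 0"
        by (simp only: summand[OF fact] if_False)
    qed
    then show ?thesis
      using rhs False unfolding convolves_def
      by (intro eventually_finite_subsets_at_top_weakI) simp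
  qed
qed

lemma convolves_all:
  assumes U: "U \<in> UF"
  shows "convolves U a b"
proof (induction a rule: span_induct)
  case zero
  show ?case using convolves_zero_left[OF U] .
next
  case (add x c k)
  have "convolves U (lscale k c) b"
    using add.hyps
    by (induction b rule: span_induct)
      (simp_all add: U convolves_zero_right convolves_add_right convolves_base)
  then show ?case using add convolves_add_left[OF U] by blast
qed

text \<open>Enlarging a sufficiently large finite set \<open>S\<close> by one factorization leaves
  the sum unchanged, so that term is zero. Hence all nonzero terms lie in \<open>S\<close>.\<close>

lemma conv_support_hat:
  assumes U: "U \<in> UF"
  shows "finite (conv_support B P (hatB a) (hatB b) U)"
    and "(\<Sum>(V, W)\<in>conv_support B P (hatB a) (hatB b) U. hatB a V * hatB b W) = chi U (a * b)"
proof -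
  let ?h = "\<lambda>(V, W). chi V a * chi W b"
  let ?C = "conv_support B P (hatB a) (hatB b) U"
  have C: "?C = {x \<in> factorizations U. ?h x \<noteq> 0}"
    by (auto simp: conv_support_def factorizations_def hat_apply)
  obtain S where S: "finite S" "S \<subseteq> factorizations U"
    "\<forall>T. finite T \<and> S \<subseteq> T \<and> T \<subseteq> factorizations U \<longrightarrow> sum ?h T = chi U (a * b)"
    using convolves_all[OF U, of a b]
    unfolding convolves_def eventually_finite_subsets_at_top by (elim exE conjE)
  have "?C \<subseteq> S"
  proof (rule ccontr)
    assume "\<not> ?C \<subseteq> S"
    then obtain x where x: "x \<in> factorizations U" "?h x \<noteq> 0" "x \<notin> S" using C by blast
    have "sum ?h (insert x S) = chi U (a * b)" "sum ?h S = chi U (a * b)"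
      using S x(1) by blast+
    moreover have "sum ?h (insert x S) = ?h x + sum ?h S" using sum.insert[OF S(1) x(3)] .
    ultimately show False using x(2) by (metis add_cancel_left_left)
  qed
  then show fin: "finite ?C" using S finite_subset by blast
  have "(\<Sum>(V, W)\<in>?C. hatB a V * hatB b W) = sum ?h ?C"
    by (intro sum.cong) (auto simp: conv_support_def hat_apply)
  also have "\<dots> = sum ?h S"
    using S \<open>?C \<subseteq> S\<close> C by (intro sum.mono_neutral_left) blast+
  finally show "(\<Sum>(V, W)\<in>?C. hatB a V * hatB b W) = chi U (a * b)" using S by simp
qed

end

theorem theorem7p6:
  fixes lscale :: "'k::{ring,monoid_mult} \<Rightarrow> 'a::ring \<Rightarrow> 'a"
    and rscale :: "'a \<Rightarrow> 'k \<Rightarrow> 'a"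
    and B P :: "'a set"
  assumes "boolean_cartan lscale rscale B P"
  shows "(\<forall>U\<in>ultrafilters B P. \<exists>!\<phi>. is_char_ext lscale rscale B U \<phi>) \<and>
    (\<forall>f\<in>(KU B P :: ('a set \<Rightarrow> 'k) set). \<forall>g\<in>KU B P. \<forall>U\<in>ultrafilters B P.
        finite (conv_support B P f g U)) \<and>
    bij_betw (hat lscale rscale B P) UNIV (KU B P) \<and>
    (\<forall>a b. hat lscale rscale B P (a + b) =
        KU_add B P (hat lscale rscale B P a) (hat lscale rscale B P b)) \<and>
    (\<forall>k a. hat lscale rscale B P (lscale k a) = KU_lscale B P k (hat lscale rscale B P a)) \<and>
    (\<forall>a k. hat lscale rscale B P (rscale a k) = KU_rscale B P (hat lscale rscale B P a) k) \<and>
    (\<forall>a b. hat lscale rscale B P (a * b) =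
        KU_conv B P (hat lscale rscale B P a) (hat lscale rscale B P b))"
proof -
  interpret boolean_cartan lscale rscale B P by (rule assms)
  show ?thesis
  proof (intro conjI ballI allI)
    fix f g :: "'a set \<Rightarrow> 'k" and U
    assume f: "f \<in> KU B P" and g: "g \<in> KU B P" and U: "U \<in> UF"
    \<comment> \<open>Surjectivity reduces finiteness for arbitrary functions to functions of the
      form \<open>hatB a\<close>.\<close>
    obtain a b where "f = hatB a" "g = hatB b" using surj_hat f g by metis
    then show "finite (conv_support B P f g U)" using conv_support_hat(1)[OF U] by simp
  next
    fix a b
    show "hatB (a + b) = KU_add B P (hatB a) (hatB b)"
      by (auto simp: hat_def KU_add_def restrict_def chi_add)
    show "hatB (a * b) = KU_conv B P (hatB a) (hatB b)"
      unfolding KU_conv_def by (subst hat_def) (auto simp: restrict_def conv_support_hat(2))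
  next
    fix k a
    show "hatB (lscale k a) = KU_lscale B P k (hatB a)"
      by (auto simp: hat_def KU_lscale_def restrict_def chi_lscale)
    show "hatB (rscale a k) = KU_rscale B P (hatB a) k"
      by (auto simp: hat_def KU_rscale_def restrict_def chi_rscale)
  qed (use ex1_char_ext bij_betw_hat in auto)
qed

end
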